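(* There is an algorithm which, given oracle access to a directed acyclic graph $G$ with $n$ vertices and $m$ edges, together with a vertex $s$, a sink vertex $t$, and a parameter $\varepsilon>0$, returns $\rho$ such that \[\bigl|\rho-\Pr[\text{a random walk from $s$ reaches $t$}]\bigr|\le\varepsilon.\] The algorithm runs in time $\widetilde{O}(nm/\varepsilon)$ and uses $O(\log(nm/\varepsilon))$ workspace and $\widetilde{O}(n\log(m/\varepsilon))$ catalytic space; it is guaranteed to restore the catalytic tape to its initial state whenever the input is valid (in particular, whenever $G$ has no cycles).
   Context: A sink is a vertex of out-degree $0$. A random walk from $s$ repeatedly moves from the current vertex to a uniformly random out-neighbor (following a uniformly random outgoing edge) until it reaches a sink. Catalytic model: read-only input, small read-write work tape, a read-write catalytic tape starting in an arbitrary configuration that must be restored exactly at halting, with constant-time random access to catalytic bits. Oracle access to $G$: vertex set $[n]$, with in-degree, out-degree, $i$-th in-neighbor and $i$-th out-neighbor queries. $\widetilde{O}(\cdot)$ hides polylogarithmic factors. *)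

theory Defs
  imports "HOL-Probability.SPMF" "HOL-Library.Log_Nat"
begin

section \<open>Random walks\<close>

text \<open>A finite simple digraph with vertex set \<open>{..<n}\<close> is its arc set
  \<open>E \<subseteq> {..<n} \<times> {..<n}\<close>; the out-neighbourhood of \<open>v\<close> is \<open>E `` {v}\<close>.\<close>

definition is_sink :: "('a \<times> 'a) set \<Rightarrow> 'a \<Rightarrow> bool" where
  "is_sink E v \<longleftrightarrow> E `` {v} = {}"

text \<open>The list of all vertices visited by the walk, in order. As a subdistribution, it gives no
  mass to walks that never reach a sink (there are none if \<open>E\<close> is finite and acyclic).\<close>

partial_function (spmf) random_walk :: "('a \<times> 'a) set \<Rightarrow> 'a \<Rightarrow> 'a list spmf" where
  "random_walk E v =
     (if is_sink E v then return_spmf [v]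
      else bind_spmf (spmf_of_set (E `` {v})) (\<lambda>w.
             bind_spmf (random_walk E w) (\<lambda>p. return_spmf (v # p))))"

definition reach_prob :: "('a \<times> 'a) set \<Rightarrow> 'a \<Rightarrow> 'a \<Rightarrow> real" where
  "reach_prob E s t = measure (measure_spmf (random_walk E s)) {p. t \<in> set p}"


section \<open>Inputs and oracle access\<close>

text \<open>The neighbour lists fix the (arbitrary) order in which the oracle enumerates neighbours.\<close>

record walk_input =
  num_verts :: nat
  arcs :: "(nat \<times> nat) set"
  out_list :: "nat \<Rightarrow> nat list"
  in_list :: "nat \<Rightarrow> nat list"
  source :: nat
  target :: nat
  accuracy :: real

definition dag_input :: "walk_input \<Rightarrow> bool" where
  "dag_input X \<longleftrightarrow>
     arcs X \<subseteq> {..<num_verts X} \<times> {..<num_verts X} \<and> acyclic (arcs X) \<and>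
     (\<forall>v < num_verts X.
        distinct (out_list X v) \<and> set (out_list X v) = arcs X `` {v} \<and>
        distinct (in_list X v) \<and> set (in_list X v) = (arcs X)\<inverse> `` {v}) \<and>
     source X < num_verts X \<and> target X < num_verts X \<and> accuracy X > 0"

text \<open>Neighbours are indexed from 0; queries that are out of range return 0.\<close>

definition query_degree :: "nat \<Rightarrow> (nat \<Rightarrow> nat list) \<Rightarrow> nat \<Rightarrow> nat" where
  "query_degree n adj v = (if v < n then length (adj v) else 0)"

definition query_neighbour :: "nat \<Rightarrow> (nat \<Rightarrow> nat list) \<Rightarrow> nat \<Rightarrow> nat \<Rightarrow> nat" where
  "query_neighbour n adj v i = (if v < n \<and> i < length (adj v) then adj v ! i else 0)"


section \<open>Catalytic machines\<close>

text \<open>A program is a finite control over finitely many work registers (named by naturals, never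
  addressed indirectly) holding binary numbers; the registers are the work tape, and the workspace
  is the total number of bits they hold. The input is read-only. The parameter
  \<open>\<epsilon>\<close>, an arbitrary positive real, can only be compared with fractions formed from work
  registers. The catalytic tape is accessed one bit at a time, at the address held in a work
  register; it is modelled as infinite, and its size is the number of leading cells that a run
  accesses.\<close>

type_synonym reg = nat

datatype arith = Plus | Monus | Times | Quotient | Remainder

datatype instr =
    Const reg nat
  | Arith arith reg reg reg
  | Get_Num_Verts reg
  | Get_Source reg
  | Get_Target reg
  | Accuracy_Ge reg reg reg
  | Out_Degree reg reg
  | In_Degree reg reg
  | Out_Neighbour reg reg reg
  | In_Neighbour reg reg reg
  | Cat_Read reg reg
  | Cat_Write reg reg

datatype program =
    Skip
  | Instr instr
  | Seq program program
  | Cond reg program program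
  | Loop reg program

record config =
  work :: "reg \<Rightarrow> nat"
  tape :: "nat \<Rightarrow> bool"

fun arith_sem :: "arith \<Rightarrow> nat \<Rightarrow> nat \<Rightarrow> nat" where
  "arith_sem Plus x y = x + y"
| "arith_sem Monus x y = x - y"
| "arith_sem Times x y = x * y"
| "arith_sem Quotient x y = x div y"
| "arith_sem Remainder x y = x mod y"

definition set_reg :: "reg \<Rightarrow> nat \<Rightarrow> config \<Rightarrow> config" where
  "set_reg r x \<sigma> = \<sigma>\<lparr>work := (work \<sigma>)(r := x)\<rparr>"

text \<open>The first register argument is the destination, except for \<open>Cat_Write a b\<close>, which
  writes the bit \<open>b\<close> (nonzero for \<open>True\<close>) at address \<open>a\<close>.
  \<open>Accuracy_Ge r a b\<close> tests \<open>a \<le> b * \<epsilon>\<close>.\<close>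

fun step :: "walk_input \<Rightarrow> instr \<Rightarrow> config \<Rightarrow> config" where
  "step X (Const r k) \<sigma> = set_reg r k \<sigma>"
| "step X (Arith f r a b) \<sigma> = set_reg r (arith_sem f (work \<sigma> a) (work \<sigma> b)) \<sigma>"
| "step X (Get_Num_Verts r) \<sigma> = set_reg r (num_verts X) \<sigma>"
| "step X (Get_Source r) \<sigma> = set_reg r (source X) \<sigma>"
| "step X (Get_Target r) \<sigma> = set_reg r (target X) \<sigma>"
| "step X (Accuracy_Ge r a b) \<sigma> =
     set_reg r (of_bool (real (work \<sigma> a) \<le> real (work \<sigma> b) * accuracy X)) \<sigma>"
| "step X (Out_Degree r a) \<sigma> =
     set_reg r (query_degree (num_verts X) (out_list X) (work \<sigma> a)) \<sigma>"
| "step X (In_Degree r a) \<sigma> =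
     set_reg r (query_degree (num_verts X) (in_list X) (work \<sigma> a)) \<sigma>"
| "step X (Out_Neighbour r a i) \<sigma> =
     set_reg r (query_neighbour (num_verts X) (out_list X) (work \<sigma> a) (work \<sigma> i)) \<sigma>"
| "step X (In_Neighbour r a i) \<sigma> =
     set_reg r (query_neighbour (num_verts X) (in_list X) (work \<sigma> a) (work \<sigma> i)) \<sigma>"
| "step X (Cat_Read r a) \<sigma> = set_reg r (of_bool (tape \<sigma> (work \<sigma> a))) \<sigma>"
| "step X (Cat_Write a b) \<sigma> = \<sigma>\<lparr>tape := (tape \<sigma>)(work \<sigma> a := (work \<sigma> b \<noteq> 0))\<rparr>"

text \<open>\<open>floorlog 2 x\<close> is the length of the binary representation of \<open>x\<close>.
  Only finitely many registers are nonzero in any configuration reached from an initial one.\<close>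

definition work_bits :: "config \<Rightarrow> nat" where
  "work_bits \<sigma> = (\<Sum>r | work \<sigma> r \<noteq> 0. floorlog 2 (work \<sigma> r))"

text \<open>The number of catalytic cells \<open>0, 1, \<dots>\<close> that must exist for the instruction.\<close>

fun cat_cells :: "instr \<Rightarrow> config \<Rightarrow> nat" where
  "cat_cells (Cat_Read r a) \<sigma> = Suc (work \<sigma> a)"
| "cat_cells (Cat_Write a b) \<sigma> = Suc (work \<sigma> a)"
| "cat_cells _ \<sigma> = 0"

text \<open>\<open>exec X P \<sigma> T w c \<sigma>'\<close>: on input \<open>X\<close>, program \<open>P\<close> started in \<open>\<sigma>\<close>
  halts in \<open>\<sigma>'\<close> after \<open>T\<close> steps, where \<open>w\<close> is the largest number of work bits
  held at any time and only the first \<open>c\<close> cells of the catalytic tape are accessed.\<close>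

inductive exec ::
  "walk_input \<Rightarrow> program \<Rightarrow> config \<Rightarrow> nat \<Rightarrow> nat \<Rightarrow> nat \<Rightarrow> config \<Rightarrow> bool"
  for X :: walk_input where
  Skip: "exec X Skip \<sigma> 1 (work_bits \<sigma>) 0 \<sigma>"
| Instr: "exec X (Instr i) \<sigma> 1 (max (work_bits \<sigma>) (work_bits (step X i \<sigma>))) (cat_cells i \<sigma>)
            (step X i \<sigma>)"
| Seq: "exec X P \<sigma> T w c \<sigma>' \<Longrightarrow> exec X Q \<sigma>' T' w' c' \<sigma>'' \<Longrightarrow>
          exec X (Seq P Q) \<sigma> (T + T') (max w w') (max c c') \<sigma>''"
| Cond_True: "work \<sigma> r \<noteq> 0 \<Longrightarrow> exec X P \<sigma> T w c \<sigma>' \<Longrightarrow>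
          exec X (Cond r P Q) \<sigma> (Suc T) w c \<sigma>'"
| Cond_False: "work \<sigma> r = 0 \<Longrightarrow> exec X Q \<sigma> T w c \<sigma>' \<Longrightarrow>
          exec X (Cond r P Q) \<sigma> (Suc T) w c \<sigma>'"
| Loop_True: "work \<sigma> r \<noteq> 0 \<Longrightarrow> exec X P \<sigma> T w c \<sigma>' \<Longrightarrow>
          exec X (Loop r P) \<sigma>' T' w' c' \<sigma>'' \<Longrightarrow>
          exec X (Loop r P) \<sigma> (Suc (T + T')) (max w w') (max c c') \<sigma>''"
| Loop_False: "work \<sigma> r = 0 \<Longrightarrow> exec X (Loop r P) \<sigma> 1 (work_bits \<sigma>) 0 \<sigma>"

inductive_cases exec_SkipE: "exec X Skip \<sigma> T w c \<sigma>'"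
inductive_cases exec_InstrE: "exec X (Instr i) \<sigma> T w c \<sigma>'"
inductive_cases exec_SeqE: "exec X (Seq P Q) \<sigma> T w c \<sigma>'"
inductive_cases exec_CondE: "exec X (Cond r P Q) \<sigma> T w c \<sigma>'"
inductive_cases exec_LoopE: "exec X (Loop r P) \<sigma> T w c \<sigma>'"

lemma exec_deterministic:
  "exec X P \<sigma> T w c \<sigma>' \<Longrightarrow> exec X P \<sigma> T' w' c' \<sigma>'' \<Longrightarrow>
     T' = T \<and> w' = w \<and> c' = c \<and> \<sigma>'' = \<sigma>'"
proof (induction arbitrary: T' w' c' \<sigma>'' rule: exec.induct)
  case Skip
  then show ?case by (elim exec_SkipE) simp
next
  case Instr
  then show ?case by (elim exec_InstrE) simp
next
  case (Seq P \<sigma> T1 w1 c1 \<sigma>1 Q T2 w2 c2 \<sigma>2)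
  from Seq.prems obtain T1' w1' c1' \<sigma>1' T2' w2' c2' where
    "exec X P \<sigma> T1' w1' c1' \<sigma>1'" "exec X Q \<sigma>1' T2' w2' c2' \<sigma>''"
    "T' = T1' + T2'" "w' = max w1' w2'" "c' = max c1' c2'"
    by (elim exec_SeqE)
  with Seq.IH(1)[OF this(1)] Seq.IH(2)[of T2' w2' c2' \<sigma>''] show ?case by simp
next
  case (Cond_True \<sigma> r P T1 w1 c1 \<sigma>1 Q)
  obtain T1' where
    "exec X P \<sigma> T1' w' c' \<sigma>''" "T' = Suc T1'"
    by (rule exec_CondE[OF Cond_True.prems]) (use Cond_True.hyps(1) in \<open>simp_all\<close>)
  with Cond_True.IH[OF this(1)] show ?case by simp
next
  case (Cond_False \<sigma> r Q T1 w1 c1 \<sigma>1 P)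
  obtain T1' where
    "exec X Q \<sigma> T1' w' c' \<sigma>''" "T' = Suc T1'"
    by (rule exec_CondE[OF Cond_False.prems]) (use Cond_False.hyps(1) in \<open>simp_all\<close>)
  with Cond_False.IH[OF this(1)] show ?case by simp
next
  case (Loop_True \<sigma> r P T1 w1 c1 \<sigma>1 T2 w2 c2 \<sigma>2)
  obtain T1' w1' c1' \<sigma>1' T2' w2' c2' where
    "exec X P \<sigma> T1' w1' c1' \<sigma>1'" "exec X (Loop r P) \<sigma>1' T2' w2' c2' \<sigma>''"
    "T' = Suc (T1' + T2')" "w' = max w1' w2'" "c' = max c1' c2'"
    by (rule exec_LoopE[OF Loop_True.prems]) (use Loop_True.hyps(1) in \<open>simp_all\<close>)
  with Loop_True.IH(1)[OF this(1)] Loop_True.IH(2)[of T2' w2' c2' \<sigma>''] show ?case by simp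
next
  case (Loop_False \<sigma> r P)
  show ?case by (rule exec_LoopE[OF Loop_False.prems]) (use Loop_False.hyps(1) in \<open>simp_all\<close>)
qed

definition initial :: "(nat \<Rightarrow> bool) \<Rightarrow> config" where
  "initial \<tau> = \<lparr>work = (\<lambda>_. 0), tape = \<tau>\<rparr>"

text \<open>The output is the rational number \<open>work \<sigma> 0 / work \<sigma> 1\<close>.\<close>

definition returns :: "config \<Rightarrow> real \<Rightarrow> bool" where
  "returns \<sigma> \<rho> \<longleftrightarrow> work \<sigma> 1 \<noteq> 0 \<and> \<rho> = real (work \<sigma> 0) / real (work \<sigma> 1)"


section \<open>Asymptotic bounds\<close>

text \<open>The convention for arguments at which the bounds are degenerate (\<open>m = 0\<close>, or \<open>\<epsilon>\<close> so large
  that \<open>n m / \<epsilon>\<close> or a logarithm drops below 1): an empty arc set counts as \<open>m = 1\<close>, and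
  quantities below 2 count as 2 where a resource bound or a logarithm is taken.
  \<open>f\<close> is in soft-O of \<open>x\<close> iff \<open>f \<le> C * soft k x\<close> for some constants \<open>C\<close> and \<open>k\<close>.\<close>

definition lg :: "real \<Rightarrow> real" where
  "lg x = log 2 (max 2 x)"

definition soft :: "nat \<Rightarrow> real \<Rightarrow> real" where
  "soft k x = max 2 x * lg x ^ k"

end

theory Submission
  imports Defs
begin

text \<open>
  Replace the random walk by a rotor walk: every vertex \<open>v\<close> owns a catalytic field of \<open>b\<close> bits
  holding some number \<open>x\<close>, and a chip at \<open>v\<close> leaves along arc number \<open>x mod deg v\<close> and increments
  \<open>x\<close> modulo \<open>K = 2 ^ b\<close>. Since consecutive chips leave \<open>v\<close> almost evenly along its arcs, and since the
  probability of reaching the target is harmonic, after \<open>K\<close> chips the number of hits differs from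
  \<open>K\<close> times this probability by at most three per arc; \<open>K\<close> is chosen as the least power of two
  that makes this at most \<open>K * \<epsilon>\<close>. To restore the tape, send another \<open>K\<close> chips which
  decrement the fields before reading them: by the abelian property of rotor walks these visit
  every vertex equally often, although in a different order.
\<close>

section \<open>Random walks and rotor walks\<close>

text \<open>The obstacle is that the initial tape is arbitrary: every bit pattern must be a legal
  rotor state and every update invertible. A counter modulo the out-degree fits no fixed number of
  bits in general, hence counters modulo a power of two; the price is a break in the round-robin
  order when a counter wraps and the out-degree does not divide \<open>K\<close>. A vertex sees at
  most \<open>K\<close> departures, hence at most one break, and this yields the constant 3. The
  second phase does not retrace the first chip by chip, as the chips may follow other paths, so only
  totals can be compared. They all come from one conservation law: the changes of a function
  \<open>f\<close> on the vertices, summed over all moves, telescope to its values where the chips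
  end minus those where they start. Three choices of \<open>f\<close> give the bound
  \<open>K\<close> on departures, the equation between departures and arrivals, and the discrepancy.
  The time is that of \<open>2 * K\<close> walks of at most \<open>n\<close> moves, each reading and
  writing one field of \<open>b\<close> bits.\<close>

lemma reach_prob_sink:
  assumes "is_sink E v"
  shows "reach_prob E v t = of_bool (v = t)"
  using assms unfolding reach_prob_def
  by (subst random_walk.simps) (auto simp: measure_spmf_return_spmf measure_return)

text \<open>First-step analysis. It can fail at \<open>v = t\<close>, since a walk from
  \<open>t\<close> has visited \<open>t\<close> whatever follows.\<close>

lemma reach_prob_step:
  assumes "finite (E `` {v})" "\<not> is_sink E v" "v \<noteq> t"
  shows "reach_prob E v t = (\<Sum>w\<in>E `` {v}. reach_prob E w t) / card (E `` {v})"
proof -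
  have "random_walk E v =
      spmf_of_set (E `` {v}) \<bind> (\<lambda>w. map_spmf ((#) v) (random_walk E w))"
    using assms(2) by (subst random_walk.simps) (simp add: map_spmf_conv_bind_spmf)
  moreover have "(#) v -` {p. t \<in> set p} = {p. t \<in> set p}"
    using assms(3) by auto
  ultimately show ?thesis
    unfolding reach_prob_def
    by (simp add: measure_spmf_bind o_def measure_map_spmf integral_spmf_of_set
        subprob_space.measure_bind[where N = "count_space UNIV"] measure_spmf.subprob_space_axioms
        space_subprob_algebra)
qed

text \<open>\<open>nb v k\<close> is the exit taken at departure number \<open>k\<close> from
  \<open>v\<close>, so the departure counts \<open>u\<close> are the whole rotor state. The fuel
  \<open>l\<close> only ensures termination; \<open>card V\<close> suffices in an acyclic
  graph.\<close>

fun route :: "('a \<times> 'a) set \<Rightarrow> ('a \<Rightarrow> nat \<Rightarrow> 'a) \<Rightarrow> nat \<Rightarrow> ('a \<Rightarrow> nat) \<Rightarrow> 'a \<Rightarrow> ('a \<Rightarrow> nat) \<times> 'a" where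
  "route E nb 0 u v = (u, v)"
| "route E nb (Suc l) u v =
     (if is_sink E v then (u, v) else route E nb l (u(v := Suc (u v))) (nb v (u v)))"

fun chips :: "('a \<times> 'a) set \<Rightarrow> ('a \<Rightarrow> nat \<Rightarrow> 'a) \<Rightarrow> nat \<Rightarrow> 'a \<Rightarrow> nat \<Rightarrow> ('a \<Rightarrow> nat) \<times> 'a list" where
  "chips E nb l s 0 = (\<lambda>_. 0, [])"
| "chips E nb l s (Suc j) =
     (case chips E nb l s j of (u, ends) \<Rightarrow>
        (case route E nb l u s of (u', v) \<Rightarrow> (u', v # ends)))"

text \<open>Regroups the changes of \<open>f\<close> along all moves by vertex. The order in which
  departures from different vertices interleave is lost here, which is the source of the abelian
  property.\<close>

definition drift :: "'a set \<Rightarrow> ('a \<Rightarrow> nat \<Rightarrow> 'a) \<Rightarrow> ('a \<Rightarrow> real) \<Rightarrow> ('a \<Rightarrow> nat) \<Rightarrow> real" where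
  "drift V nb f u = (\<Sum>v\<in>V. \<Sum>k<u v. f (nb v k) - f v)"

locale rotor =
  fixes V :: "'a set" and E :: "('a \<times> 'a) set" and nb :: "'a \<Rightarrow> nat \<Rightarrow> 'a"
  assumes finite_V: "finite V"
    and arcs: "E \<subseteq> V \<times> V"
    and acyclic: "acyclic E"
    and nb: "\<And>v k. \<not> is_sink E v \<Longrightarrow> (v, nb v k) \<in> E"
begin

lemma finite_E: "finite E"
  using finite_subset[OF arcs] finite_V by blast

lemma is_sink_iff: "is_sink E v \<longleftrightarrow> (\<forall>w. (v, w) \<notin> E)"
  by (auto simp: is_sink_def)

lemma drift_step:
  assumes "v \<in> V"
  shows "drift V nb f (u(v := Suc (u v))) = drift V nb f u + f (nb v (u v)) - f v"
  unfolding drift_def using assms finite_V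
  by (simp add: sum.remove[of V v] algebra_simps)

lemma route_drift:
  assumes "v \<in> V" "route E nb l u v = (u', v')"
  shows "v' \<in> V" "f v' - f v = drift V nb f u' - drift V nb f u"
proof -
  have "v' \<in> V \<and> f v' - f v = drift V nb f u' - drift V nb f u"
    using assms
  proof (induction l arbitrary: u v)
    case (Suc l)
    show ?case
    proof (cases "is_sink E v")
      case False
      then have "nb v (u v) \<in> V" using nb arcs by blast
      moreover have "route E nb l (u(v := Suc (u v))) (nb v (u v)) = (u', v')"
        using Suc.prems(2) False by simp
      ultimately have "v' \<in> V \<and> f v' - f (nb v (u v)) =
          drift V nb f u' - drift V nb f (u(v := Suc (u v)))"
        by (rule Suc.IH)
      then show ?thesis using drift_step[OF Suc.prems(1), of f u] by simp
    qed (use Suc in auto)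
  qed auto
  then show "v' \<in> V" "f v' - f v = drift V nb f u' - drift V nb f u" by auto
qed

text \<open>Each move strictly shrinks the set of vertices reachable by a nonempty path: acyclicity
  removes the new position from it. Its size thus bounds the moves left.\<close>

lemma route_sink:
  assumes "card (E\<^sup>+ `` {v}) \<le> l"
  shows "is_sink E (snd (route E nb l u v))"
  using assms
proof (induction l arbitrary: u v)
  case 0
  have "finite (E\<^sup>+ `` {v})" using finite_E by (simp add: finite_Image)
  with 0 have "E\<^sup>+ `` {v} = {}" by simp
  then show ?case by (auto simp: is_sink_iff)
next
  case (Suc l)
  show ?case
  proof (cases "is_sink E v")
    case False
    define w where "w = nb v (u v)"
    have vw: "(v, w) \<in> E" using nb False by (simp add: w_def)
    have "finite (E\<^sup>+ `` {v})" using finite_E by (simp add: finite_Image)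
    moreover have "E\<^sup>+ `` {w} \<subset> E\<^sup>+ `` {v}"
      using vw acyclic by (auto simp: acyclic_def intro: trancl_into_trancl2)
    ultimately have "card (E\<^sup>+ `` {w}) < card (E\<^sup>+ `` {v})" by (rule psubset_card_mono)
    with Suc False show ?thesis by (simp add: w_def)
  qed simp
qed

lemma route_card_sink: "is_sink E (snd (route E nb (card V) u v))"
proof (rule route_sink)
  have "E\<^sup>+ \<subseteq> V \<times> V" using arcs by (rule trancl_subset_Sigma)
  then show "card (E\<^sup>+ `` {v}) \<le> card V"
    using finite_V by (intro card_mono) auto
qed

lemma route_sink_unused:
  "is_sink E x \<Longrightarrow> fst (route E nb l u v) x = u x"
  by (induction l arbitrary: u v) auto

text \<open>Conservation law: \<open>route_drift\<close> telescopes each chip, and the chips add up.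
  The use lies in the choice of \<open>f\<close>: ancestors of \<open>v\<close> in
  \<open>chips_le\<close>, a single vertex in \<open>chips_arrivals\<close>, the reaching
  probability in \<open>chips_discrepancy\<close>.\<close>

lemma chips_balance:
  assumes "s \<in> V" "chips E nb (card V) s j = (u, ends)"
  shows "(\<Sum>v\<leftarrow>ends. f v) - j * f s = drift V nb f u"
    and "length ends = j"
    and "\<forall>v\<in>set ends. is_sink E v"
    and "\<forall>v. is_sink E v \<longrightarrow> u v = 0"
proof -
  have "(\<Sum>v\<leftarrow>ends. f v) - j * f s = drift V nb f u \<and> length ends = j \<and>
      (\<forall>v\<in>set ends. is_sink E v) \<and> (\<forall>v. is_sink E v \<longrightarrow> u v = 0)"
    using assms(2)
  proof (induction j arbitrary: u ends)
    case 0
    then show ?case by (auto simp: drift_def)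
  next
    case (Suc j)
    obtain u0 ends0 where c: "chips E nb (card V) s j = (u0, ends0)" by fastforce
    obtain v where r: "route E nb (card V) u0 s = (u, v)" and e: "ends = v # ends0"
      using Suc.prems c by (auto split: prod.splits)
    show ?case
      using Suc.IH[OF c] route_drift(2)[OF assms(1) r, of f] route_card_sink[of u0 s]
        route_sink_unused[of _ "card V" u0 s] r e
      by (auto simp: algebra_simps)
  qed
  then show "(\<Sum>v\<leftarrow>ends. f v) - j * f s = drift V nb f u" "length ends = j"
    "\<forall>v\<in>set ends. is_sink E v" "\<forall>v. is_sink E v \<longrightarrow> u v = 0" by auto
qed

text \<open>Test the balance equation on the indicator of the vertices from which \<open>v\<close> can be reached:
  it never increases along an arc and drops from 1 to 0 at each departure from \<open>v\<close>.\<close>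

lemma chips_le:
  assumes "s \<in> V" "chips E nb (card V) s j = (u, ends)"
  shows "u v \<le> j"
proof (cases "is_sink E v")
  case True
  then show ?thesis using chips_balance(4)[OF assms] by simp
next
  case False
  define f :: "'a \<Rightarrow> real" where "f x = of_bool ((x, v) \<in> E\<^sup>*)" for x
  have v: "v \<in> V" using nb[OF False] arcs by blast
  have mono: "f (nb x k) - f x \<le> 0" if "\<not> is_sink E x" for x k
    using nb[OF that] by (auto simp: f_def intro: converse_rtrancl_into_rtrancl)
  have "f (nb v k) - f v = -1" for k
    using nb[OF False, of k] acyclic rtrancl_into_trancl2[of v "nb v k" E v]
    by (auto simp: f_def acyclic_def)
  then have "(\<Sum>k<u v. f (nb v k) - f v) = - real (u v)" by simp
  moreover have "(\<Sum>k<u x. f (nb x k) - f x) \<le> 0" for x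
    using mono chips_balance(4)[OF assms] by (cases "is_sink E x") (auto intro: sum_nonpos)
  ultimately have "drift V nb f u \<le> - real (u v)"
    unfolding drift_def using v finite_V
    by (subst sum.remove[of V v]) (simp_all add: sum_nonpos)
  moreover have "0 \<le> (\<Sum>v\<leftarrow>ends. f v)" by (rule sum_list_nonneg) (auto simp: f_def)
  moreover have "f s \<le> 1" by (simp add: f_def)
  then have "j * f s \<le> j" by (simp add: mult_left_le)
  ultimately show ?thesis using chips_balance(1)[OF assms, of f] by simp
qed

text \<open>The balance equation for the indicator of \<open>w\<close>. Final positions drop out,
  since every chip ends at a sink and \<open>w\<close> is none.\<close>

lemma chips_arrivals:
  assumes "s \<in> V" "chips E nb (card V) s j = (u, ends)" "\<not> is_sink E w"
  shows "u w = j * of_bool (w = s) + (\<Sum>v\<in>V. card {k. k < u v \<and> nb v k = w})"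
proof -
  define f :: "'a \<Rightarrow> real" where "f x = of_bool (x = w)" for x
  have w: "w \<in> V" using nb[OF assms(3)] arcs by blast
  have "map f ends = map (\<lambda>_. 0) ends"
    using chips_balance(3)[OF assms(1,2)] assms(3) by (auto simp: f_def)
  then have "(\<Sum>v\<leftarrow>ends. f v) = (\<Sum>v\<leftarrow>ends. 0)" by (simp only:)
  then have "(\<Sum>v\<leftarrow>ends. f v) = 0" by simp
  moreover have "(\<Sum>k<u v. f (nb v k)) = card {k. k < u v \<and> nb v k = w}" for v
    by (simp add: f_def sum.If_cases of_bool_def Int_def conj_commute)
  then have "drift V nb f u =
      (\<Sum>v\<in>V. real (card {k. k < u v \<and> nb v k = w})) - (\<Sum>v\<in>V. u v * f v)"
    by (simp add: drift_def sum_subtractf)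
  moreover have "(\<Sum>v\<in>V. u v * f v) = u w"
    using w finite_V by (simp add: f_def of_bool_def if_distrib cong: if_cong)
  ultimately have "real (u w) = j * f s + (\<Sum>v\<in>V. real (card {k. k < u v \<and> nb v k = w}))"
    using chips_balance(1)[OF assms(1,2), of f] by simp
  also have "\<dots> = real (j * of_bool (w = s) + (\<Sum>v\<in>V. card {k. k < u v \<and> nb v k = w}))"
    by (auto simp: f_def)
  finally show ?thesis by (simp only: of_nat_eq_iff)
qed

end

text \<open>The abelian property: the visit counts are determined by the multisets of exits taken, not
  by their order. Hence running the rotors backwards visits each vertex equally often.\<close>

lemma chips_reverse:
  assumes "rotor V E nb" "rotor V E nb'" "s \<in> V"
    and u: "chips E nb (card V) s j = (u, ends)"
    and u': "chips E nb' (card V) s j = (u', ends')"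
    and rev: "\<And>v k. k < u v \<Longrightarrow> \<not> is_sink E v \<Longrightarrow> nb' v k = nb v (u v - Suc k)"
  shows "u' = u"
proof
  fix v
  interpret R: rotor V E nb by fact
  interpret R': rotor V E nb' by fact
  \<comment> \<open>Counts are compared upstream first: the induction hypothesis covers every
    in-neighbour of \<open>w\<close>.\<close>
  have "wf E" using R.finite_E R.acyclic by (rule finite_acyclic_wf)
  then show "u' v = u v"
  proof (induction v rule: wf_induct_rule)
    case (less w)
    show ?case
    proof (cases "is_sink E w")
      case True
      then show ?thesis
        using R.chips_balance(4)[OF assms(3) u] R'.chips_balance(4)[OF assms(3) u'] by simp
    next
      case False
      have "card {k. k < u' v \<and> nb' v k = w} = card {k. k < u v \<and> nb v k = w}" for v
      proof (cases "(v, w) \<in> E")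
        case True
        then have ns: "\<not> is_sink E v" by (auto simp: R.is_sink_iff)
        \<comment> \<open>By induction both runs leave \<open>v\<close> equally often, the second
          one taking the same exits last to first; reflecting the index matches their uses of the
          arc \<open>(v, w)\<close>.\<close>
        have "bij_betw (\<lambda>k. u v - Suc k) {k. k < u v \<and> nb' v k = w} {k. k < u v \<and> nb v k = w}"
          by (rule bij_betwI[where g = "\<lambda>k. u v - Suc k"]) (auto simp: rev ns)
        then show ?thesis using bij_betw_same_card less[OF True] by fastforce
      next
        case no_arc: False
        have "{k. k < u v \<and> nb v k = w} = {}" "{k. k < u' v \<and> nb' v k = w} = {}"
          using R.chips_balance(4)[OF assms(3) u] R'.chips_balance(4)[OF assms(3) u']
            R.nb[of v] R'.nb[of v] no_arc by (cases "is_sink E v"; auto)+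
        then show ?thesis by (simp only:)
      qed
      then show ?thesis
        using R.chips_arrivals[OF assms(3) u False] R'.chips_arrivals[OF assms(3) u' False] by simp
    qed
  qed
qed

section \<open>Discrepancy of a single rotor\<close>

lemma sum_lessThan_add:
  fixes f :: "nat \<Rightarrow> 'a::comm_monoid_add"
  shows "(\<Sum>k<a + b. f k) = (\<Sum>k<a. f k) + (\<Sum>k<b. f (a + k))"
  by (induction b) (simp_all add: add.assoc)

text \<open>Whole periods cancel, so fewer than \<open>d\<close> terms of absolute value at most 1
  remain.\<close>

lemma periodic_sum_bound:
  fixes p :: "nat \<Rightarrow> real"
  assumes "d > 0" "(\<Sum>k<d. p k) = 0" "\<And>k. k < d \<Longrightarrow> \<bar>p k\<bar> \<le> 1"
  shows "\<bar>\<Sum>k<y. p (k mod d)\<bar> \<le> d"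
proof (induction y rule: less_induct)
  case (less y)
  show ?case
  proof (cases "y < d")
    case True
    have "\<bar>\<Sum>k<y. p (k mod d)\<bar> \<le> (\<Sum>k<y. \<bar>p (k mod d)\<bar>)" by (rule sum_abs)
    also have "\<dots> \<le> (\<Sum>k<y. 1)" using assms by (intro sum_mono) simp
    finally show ?thesis using True by simp
  next
    case False
    have "(\<Sum>k<y. p (k mod d)) = (\<Sum>k<d + (y - d). p (k mod d))" using False by simp
    also have "\<dots> = (\<Sum>k<y - d. p (k mod d))"
      unfolding sum_lessThan_add using assms(2) by simp
    finally show ?thesis using less[of "y - d"] False assms(1) by simp
  qed
qed

text \<open>Since at most \<open>K\<close> steps are taken, the counter modulo \<open>K\<close> wraps around at most once, so that
  the sum consists of at most three incomplete periods.\<close>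

lemma wrapped_sum_bound:
  fixes p :: "nat \<Rightarrow> real"
  assumes "d > 0" "(\<Sum>k<d. p k) = 0" "\<And>k. k < d \<Longrightarrow> \<bar>p k\<bar> \<le> 1" and "g < K" "u \<le> K"
  shows "\<bar>\<Sum>k<u. p ((g + k) mod K mod d)\<bar> \<le> 3 * d"
proof -
  define F where "F y = (\<Sum>k<y. p (k mod d))" for y
  have F: "\<bar>F y\<bar> \<le> d" for y
    unfolding F_def by (rule periodic_sum_bound) (use assms in auto)
  have seg: "(\<Sum>k<u. p ((g + k) mod K mod d)) = F (g + u) - F g" if "g + u \<le> K" for u
    using that by (simp add: F_def sum_lessThan_add)
  show ?thesis
  proof (cases "g + u \<le> K")
    case True
    then show ?thesis using seg[of u] F[of g] F[of "g + u"] by linarith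
  next
    case False
    define r where "r = g + u - K"
    have u: "u = (K - g) + r" "r \<le> K" using False assms(4,5) by (auto simp: r_def)
    have "(\<Sum>k<r. p ((g + (K - g + k)) mod K mod d)) = F r"
      unfolding F_def using u(2) assms(4) by (intro sum.cong) (auto simp: mod_add_self1)
    \<comment> \<open>\<open>F K\<close> need not vanish, as \<open>d\<close> need not divide
      \<open>K\<close>; so all three partial sums count.\<close>
    then have "(\<Sum>k<u. p ((g + k) mod K mod d)) = F K - F g + F r"
      unfolding u(1) sum_lessThan_add using seg[of "K - g"] assms(4) by simp
    then show ?thesis using F[of K] F[of g] F[of r] by linarith
  qed
qed

text \<open>One formula for both phases: \<open>K - 1\<close> acts as -1 modulo \<open>K\<close>
  without leaving the naturals. With \<open>e = 0\<close> the field is read before its update, with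
  \<open>e = \<delta>\<close> after it.\<close>

definition exit :: "walk_input \<Rightarrow> nat \<Rightarrow> nat \<Rightarrow> nat \<Rightarrow> (nat \<Rightarrow> nat) \<Rightarrow> nat \<Rightarrow> nat \<Rightarrow> nat" where
  "exit X K \<delta> e g v k = out_list X v ! ((g v + k * \<delta> + e) mod K mod length (out_list X v))"

section \<open>Rotors of an input: accuracy and restoration\<close>

locale dag =
  fixes X :: walk_input
  assumes dag_input: "dag_input X"
begin

abbreviation "V \<equiv> {..<num_verts X}"
abbreviation "E \<equiv> arcs X"

lemma arcs: "E \<subseteq> V \<times> V" and acyclic: "acyclic E"
  and source: "source X < num_verts X" and target: "target X < num_verts X"
  and accuracy: "accuracy X > 0"
  using dag_input by (auto simp: dag_input_def)

lemma finite_arcs: "finite E"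
  using finite_subset[OF arcs] by blast

lemma out_list: "v \<in> V \<Longrightarrow> distinct (out_list X v)" "v \<in> V \<Longrightarrow> set (out_list X v) = E `` {v}"
  using dag_input by (auto simp: dag_input_def)

lemma is_sink_iff_out_list: "v \<in> V \<Longrightarrow> is_sink E v \<longleftrightarrow> out_list X v = []"
  using out_list(2)[of v] by (auto simp: is_sink_def)

lemma non_sink: "\<not> is_sink E v \<Longrightarrow> v \<in> V"
  using arcs by (auto simp: is_sink_def)

lemma rotor_exit: "rotor V E (exit X K \<delta> e g)"
proof
  fix v k assume "\<not> is_sink E v"
  then have "v \<in> V" "out_list X v \<noteq> []" using non_sink is_sink_iff_out_list by auto
  then have "exit X K \<delta> e g v k \<in> set (out_list X v)"
    by (simp add: exit_def)
  then show "(v, exit X K \<delta> e g v k) \<in> E" using out_list(2)[OF \<open>v \<in> V\<close>] by simp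
qed (use arcs acyclic in auto)

lemma sum_out_degree: "(\<Sum>v\<in>V. length (out_list X v)) = card E"
proof -
  have "length (out_list X v) = card (E `` {v})" if "v \<in> V" for v
    using distinct_card[OF out_list(1)[OF that]] out_list(2)[OF that] by simp
  then have "(\<Sum>v\<in>V. length (out_list X v)) = (\<Sum>v\<in>V. card (E `` {v}))" by simp
  also have "\<dots> = card (Sigma V (\<lambda>v. E `` {v}))"
    using finite_arcs by (simp add: card_SigmaI finite_Image)
  also have "Sigma V (\<lambda>v. E `` {v}) = E" using arcs by auto
  finally show ?thesis .
qed

lemma reach_prob_bounds: "reach_prob E v t \<in> {0..1}"
  by (simp add: reach_prob_def measure_spmf.subprob_measure_le_1)

text \<open>Harmonicity in the form that \<open>wrapped_sum_bound\<close> consumes: a full turn of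
  the rotor has no net effect. That \<open>t\<close> is a sink excludes
  \<open>v = t\<close>.\<close>

lemma reach_prob_balanced:
  assumes "\<not> is_sink E v" "is_sink E t"
  shows "(\<Sum>k<length (out_list X v). reach_prob E (out_list X v ! k) t - reach_prob E v t) = 0"
proof -
  have v: "v \<in> V" using non_sink assms(1) .
  have "v \<noteq> t" using assms by auto
  have card: "card (E `` {v}) = length (out_list X v)"
    using distinct_card[OF out_list(1)[OF v]] out_list(2)[OF v] by simp
  have "(\<Sum>k<length (out_list X v). reach_prob E (out_list X v ! k) t) =
      (\<Sum>w\<leftarrow>out_list X v. reach_prob E w t)"
    by (simp add: sum_list_sum_nth atLeast0LessThan)
  also have "\<dots> = (\<Sum>w\<in>E `` {v}. reach_prob E w t)"
    using out_list[OF v] by (simp add: sum_list_distinct_conv_sum_set)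
  also have "\<dots> = card (E `` {v}) * reach_prob E v t"
    using reach_prob_step[of E v t] assms(1) \<open>v \<noteq> t\<close> finite_arcs
    by (auto simp: is_sink_def finite_Image)
  finally show ?thesis by (simp add: sum_subtractf card)
qed

text \<open>The balance equation for the reaching probability \<open>h\<close>. At sinks
  \<open>h\<close> is 0 or 1, so the final positions count the hits; each vertex contributes at most
  three times its out-degree, where \<open>chips_le\<close> supplies the bound on its
  departures.\<close>

lemma chips_discrepancy:
  assumes "chips E (exit X K 1 0 g) (num_verts X) s K = (u, ends)"
    and "s \<in> V" "is_sink E t" "\<And>v. g v < K"
  shows "\<bar>count_list ends t - K * reach_prob E s t\<bar> \<le> 3 * card E"
proof -
  let ?nb = "exit X K 1 0 g"
  define h where "h v = reach_prob E v t" for v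
  define D where "D v = (\<Sum>k<u v. h (?nb v k) - h v)" for v
  interpret rotor V E ?nb by (rule rotor_exit)
  have ch: "chips E ?nb (card V) s K = (u, ends)" using assms(1) by simp
  have ends: "h v = of_bool (v = t)" if "v \<in> set ends" for v
    using chips_balance(3)[OF assms(2) ch] that reach_prob_sink[of E v t] by (simp add: h_def)
  then have "(\<Sum>v\<leftarrow>ends. h v) = count_list ends t"
    by (induction ends) auto
  then have "count_list ends t - K * h s = (\<Sum>v\<in>V. D v)"
    using chips_balance(1)[OF assms(2) ch, of h] by (simp add: drift_def D_def)
  also have "\<bar>\<Sum>v\<in>V. D v\<bar> \<le> (\<Sum>v\<in>V. 3 * real (length (out_list X v)))"
  proof (rule order.trans[OF sum_abs], rule sum_mono)
    fix v assume v: "v \<in> V"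
    show "\<bar>D v\<bar> \<le> 3 * real (length (out_list X v))"
    proof (cases "is_sink E v")
      case True
      then show ?thesis using chips_balance(4)[OF assms(2) ch] by (simp add: D_def)
    next
      case False
      have "\<bar>\<Sum>k<u v. (\<lambda>i. h (out_list X v ! i) - h v)
          ((g v + k) mod K mod length (out_list X v))\<bar> \<le> 3 * length (out_list X v)"
      proof (rule wrapped_sum_bound)
        show "(\<Sum>i<length (out_list X v). h (out_list X v ! i) - h v) = 0"
          unfolding h_def using reach_prob_balanced[OF False assms(3)] .
        show "\<bar>h (out_list X v ! i) - h v\<bar> \<le> 1" for i
          using reach_prob_bounds[of "out_list X v ! i" t] reach_prob_bounds[of v t]
          by (auto simp: h_def)
      qed (use False v is_sink_iff_out_list assms(4) chips_le[OF assms(2) ch] in auto)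
      then show ?thesis by (simp add: D_def exit_def)
    qed
  qed
  finally show ?thesis
    by (simp add: h_def sum_out_degree flip: sum_distrib_left of_nat_sum)
qed

text \<open>Backward departure number \<open>k\<close> from \<open>v\<close> reads the field after
  \<open>k + 1\<close> decrements of \<open>g v + u v\<close>, which is the value read by forward
  departure \<open>u v - Suc k\<close>. So the exits are reversed and \<open>chips_reverse\<close>
  applies.\<close>

lemma chips_restore:
  assumes u: "chips E (exit X K 1 0 g) (num_verts X) s j = (u, ends)"
    and u': "chips E (exit X K (K - 1) (K - 1) (\<lambda>v. (g v + u v) mod K)) (num_verts X) s j
        = (u', ends')"
    and "s \<in> V" "\<And>v. g v < K"
  shows "((g v + u v) mod K + u' v * (K - 1)) mod K = g v"
proof -
  obtain L where K: "K = Suc L" using assms(4)[of v] by (cases K) auto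
  have "u' = u"
  proof (rule chips_reverse[OF rotor_exit rotor_exit assms(3)])
    fix v k assume k: "k < u v"
    define r where "r = u v - Suc k"
    have r: "u v = r + Suc k" using k by (simp add: r_def)
    have "((g v + u v) mod K + k * (K - 1) + (K - 1)) mod K = ((g v + u v) + k * L + L) mod K"
      by (simp add: K mod_simps add.assoc)
    also have "(g v + u v) + k * L + L = g v + r + Suc k * K" by (simp add: r K algebra_simps)
    also have "\<dots> mod K = (g v + r) mod K" by (rule mod_mult_self1)
    finally show "exit X K (K - 1) (K - 1) (\<lambda>v. (g v + u v) mod K) v k =
        exit X K 1 0 g v (u v - Suc k)"
      by (simp add: exit_def r_def)
  qed (use u u' in simp_all)
  \<comment> \<open>With equal counts, \<open>u v + u v * (K - 1) = u v * K\<close> vanishes modulo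
    \<open>K\<close>.\<close>
  have "((g v + u v) mod K + u' v * (K - 1)) mod K = (g v + u v * K) mod K"
    by (simp add: \<open>u' = u\<close> K mod_simps algebra_simps)
  then show ?thesis using assms(4) by simp
qed

end

section \<open>Bounded execution\<close>

text \<open>Weakens the exact costs of \<open>exec\<close> to upper bounds: the space bounds
  \<open>W\<close> and \<open>c\<close> stay fixed under composition and only times add up.\<close>

definition run :: "walk_input \<Rightarrow> nat \<Rightarrow> nat \<Rightarrow> program \<Rightarrow> config \<Rightarrow> nat \<Rightarrow> config \<Rightarrow> bool" where
  "run X W c P \<sigma> T \<sigma>' \<longleftrightarrow> (\<exists>T' w c'. exec X P \<sigma> T' w c' \<sigma>' \<and> T' \<le> T \<and> w \<le> W \<and> c' \<le> c)"

lemma run_mono: "run X W c P \<sigma> T \<sigma>' \<Longrightarrow> T \<le> T' \<Longrightarrow> run X W c P \<sigma> T' \<sigma>'"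
  unfolding run_def by (meson order.trans)

lemma run_Seq:
  "run X W c P \<sigma> T \<sigma>' \<Longrightarrow> run X W c Q \<sigma>' T' \<sigma>'' \<Longrightarrow> run X W c (Seq P Q) \<sigma> (T + T') \<sigma>''"
  unfolding run_def by (meson add_mono exec.Seq max.boundedI)

lemma run_Cond_True:
  "work \<sigma> r \<noteq> 0 \<Longrightarrow> run X W c P \<sigma> T \<sigma>' \<Longrightarrow> run X W c (Cond r P Q) \<sigma> (Suc T) \<sigma>'"
  unfolding run_def by (meson Suc_le_mono exec.Cond_True)

lemma run_Cond_False:
  "work \<sigma> r = 0 \<Longrightarrow> run X W c Q \<sigma> T \<sigma>' \<Longrightarrow> run X W c (Cond r P Q) \<sigma> (Suc T) \<sigma>'"
  unfolding run_def by (meson Suc_le_mono exec.Cond_False)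

lemma run_Loop_True:
  "work \<sigma> r \<noteq> 0 \<Longrightarrow> run X W c P \<sigma> T \<sigma>' \<Longrightarrow> run X W c (Loop r P) \<sigma>' T' \<sigma>'' \<Longrightarrow>
     run X W c (Loop r P) \<sigma> (Suc (T + T')) \<sigma>''"
  unfolding run_def by (meson Suc_le_mono add_mono exec.Loop_True max.boundedI)

lemma run_Loop_False:
  "work \<sigma> r = 0 \<Longrightarrow> work_bits \<sigma> \<le> W \<Longrightarrow> run X W c (Loop r P) \<sigma> 1 \<sigma>"
  unfolding run_def by (meson exec.Loop_False le_refl zero_le)

text \<open>\<open>S\<close> lists the states at the loop head and so plays the part of an
  invariant. The extra units of time pay for the tests, including the failing one.\<close>

lemma run_Loop:
  assumes "\<And>i. i < k \<Longrightarrow> work (S i) r \<noteq> 0"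
    and "\<And>i. i < k \<Longrightarrow> run X W c P (S i) T (S (Suc i))"
    and "work (S k) r = 0" "work_bits (S k) \<le> W"
  shows "run X W c (Loop r P) (S 0) (k * Suc T + 1) (S k)"
  using assms
proof (induction k arbitrary: S)
  case 0
  then show ?case using run_Loop_False by simp
next
  case (Suc k)
  have "run X W c (Loop r P) (S (Suc 0)) (k * Suc T + 1) (S (Suc k))"
    using Suc.prems by (intro Suc.IH[of "\<lambda>i. S (Suc i)"]) auto
  from run_Loop_True[OF Suc.prems(1)[of 0] Suc.prems(2)[of 0] this]
  show ?case by (simp add: add.commute add.left_commute)
qed

definition mk :: "nat list \<Rightarrow> (nat \<Rightarrow> bool) \<Rightarrow> config" where
  "mk xs \<tau> = \<lparr>work = (\<lambda>r. if r < length xs then xs ! r else 0), tape = \<tau>\<rparr>"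

lemma work_mk: "r < length xs \<Longrightarrow> work (mk xs \<tau>) r = xs ! r"
  and tape_mk: "tape (mk xs \<tau>) = \<tau>"
  by (simp_all add: mk_def)

lemma set_reg_mk: "r < length xs \<Longrightarrow> set_reg r x (mk xs \<tau>) = mk (xs[r := x]) \<tau>"
  by (auto simp: set_reg_def mk_def fun_eq_iff nth_list_update)

lemma work_bits_mk:
  assumes "\<forall>x\<in>set xs. x \<le> B" "length xs = R"
  shows "work_bits (mk xs \<tau>) \<le> R * floorlog 2 B"
proof -
  have sub: "{r. work (mk xs \<tau>) r \<noteq> 0} \<subseteq> {..<R}" using assms(2) by (auto simp: mk_def)
  have "work_bits (mk xs \<tau>) \<le> (\<Sum>r\<in>{r. work (mk xs \<tau>) r \<noteq> 0}. floorlog 2 B)"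
    unfolding work_bits_def using sub assms
    by (intro sum_mono floorlog_mono) (auto simp: mk_def)
  also have "\<dots> \<le> card {..<R} * floorlog 2 B"
    using card_mono[OF _ sub] by (simp only: sum_constant of_nat_id mult_le_mono1 finite_lessThan)
  finally show ?thesis by simp
qed

definition block :: "instr list \<Rightarrow> program" where
  "block is = foldr (\<lambda>i P. Seq (Instr i) P) is Skip"

fun block_sem ::
  "walk_input \<Rightarrow> nat \<Rightarrow> nat \<Rightarrow> nat \<Rightarrow> instr list \<Rightarrow> nat list \<Rightarrow> (nat \<Rightarrow> bool) \<Rightarrow>
    nat list \<Rightarrow> (nat \<Rightarrow> bool) \<Rightarrow> bool" where
  "block_sem X R B c [] xs \<tau> ys \<tau>' \<longleftrightarrow> ys = xs \<and> \<tau>' = \<tau>"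
| "block_sem X R B c (Const r k # is) xs \<tau> ys \<tau>' \<longleftrightarrow>
     r < R \<and> k \<le> B \<and>
     block_sem X R B c is (xs[r := k]) \<tau> ys \<tau>'"
| "block_sem X R B c (Arith f r a b # is) xs \<tau> ys \<tau>' \<longleftrightarrow>
     r < R \<and> a < R \<and> b < R \<and> arith_sem f (xs ! a) (xs ! b) \<le> B \<and>
     block_sem X R B c is (xs[r := arith_sem f (xs ! a) (xs ! b)]) \<tau> ys \<tau>'"
| "block_sem X R B c (Get_Num_Verts r # is) xs \<tau> ys \<tau>' \<longleftrightarrow>
     r < R \<and> num_verts X \<le> B \<and>
     block_sem X R B c is (xs[r := num_verts X]) \<tau> ys \<tau>'"
| "block_sem X R B c (Get_Source r # is) xs \<tau> ys \<tau>' \<longleftrightarrow>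
     r < R \<and> source X \<le> B \<and>
     block_sem X R B c is (xs[r := source X]) \<tau> ys \<tau>'"
| "block_sem X R B c (Get_Target r # is) xs \<tau> ys \<tau>' \<longleftrightarrow>
     r < R \<and> target X \<le> B \<and>
     block_sem X R B c is (xs[r := target X]) \<tau> ys \<tau>'"
| "block_sem X R B c (Accuracy_Ge r a b # is) xs \<tau> ys \<tau>' \<longleftrightarrow>
     r < R \<and> a < R \<and> b < R \<and> of_bool (real (xs ! a) \<le> real (xs ! b) * accuracy X) \<le> B \<and>
     block_sem X R B c is (xs[r := of_bool (real (xs ! a) \<le> real (xs ! b) * accuracy X)]) \<tau> ys \<tau>'"
| "block_sem X R B c (Out_Degree r a # is) xs \<tau> ys \<tau>' \<longleftrightarrow>
     r < R \<and> a < R \<and> query_degree (num_verts X) (out_list X) (xs ! a) \<le> B \<and>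
     block_sem X R B c is (xs[r := query_degree (num_verts X) (out_list X) (xs ! a)]) \<tau> ys \<tau>'"
| "block_sem X R B c (Out_Neighbour r a j # is) xs \<tau> ys \<tau>' \<longleftrightarrow>
     r < R \<and> a < R \<and> j < R \<and> query_neighbour (num_verts X) (out_list X) (xs ! a) (xs ! j) \<le> B \<and>
     block_sem X R B c is (xs[r := query_neighbour (num_verts X) (out_list X) (xs ! a) (xs ! j)]) \<tau> ys \<tau>'"
| "block_sem X R B c (In_Degree r a # is) xs \<tau> ys \<tau>' \<longleftrightarrow>
     r < R \<and> a < R \<and> query_degree (num_verts X) (in_list X) (xs ! a) \<le> B \<and>
     block_sem X R B c is (xs[r := query_degree (num_verts X) (in_list X) (xs ! a)]) \<tau> ys \<tau>'"
| "block_sem X R B c (In_Neighbour r a j # is) xs \<tau> ys \<tau>' \<longleftrightarrow>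
     r < R \<and> a < R \<and> j < R \<and> query_neighbour (num_verts X) (in_list X) (xs ! a) (xs ! j) \<le> B \<and>
     block_sem X R B c is (xs[r := query_neighbour (num_verts X) (in_list X) (xs ! a) (xs ! j)]) \<tau> ys \<tau>'"
| "block_sem X R B c (Cat_Read r a # is) xs \<tau> ys \<tau>' \<longleftrightarrow>
     r < R \<and> a < R \<and> of_bool (\<tau> (xs ! a)) \<le> B \<and> xs ! a < c \<and>
     block_sem X R B c is (xs[r := of_bool (\<tau> (xs ! a))]) \<tau> ys \<tau>'"
| "block_sem X R B c (Cat_Write a b # is) xs \<tau> ys \<tau>' \<longleftrightarrow>
     a < R \<and> b < R \<and> xs ! a < c \<and>
     block_sem X R B c is xs (\<tau>(xs ! a := xs ! b \<noteq> 0)) ys \<tau>'"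

lemma run_Instr:
  "work_bits \<sigma> \<le> W \<Longrightarrow> work_bits (step X i \<sigma>) \<le> W \<Longrightarrow> cat_cells i \<sigma> \<le> c \<Longrightarrow>
     run X W c (Instr i) \<sigma> 1 (step X i \<sigma>)"
  unfolding run_def using exec.Instr[of X i \<sigma>] by fastforce

lemma run_block:
  assumes "block_sem X R B c is xs \<tau> ys \<tau>'" "length xs = R" "\<forall>x\<in>set xs. x \<le> B"
  shows "run X (R * floorlog 2 B) c (block is) (mk xs \<tau>) (Suc (length is)) (mk ys \<tau>')"
  using assms
proof (induction "is" arbitrary: xs \<tau>)
  case Nil
  then show ?case
    unfolding block_def run_def
    using exec.Skip[of X "mk xs \<tau>"] work_bits_mk[of xs B R \<tau>] by fastforce
next
  case (Cons i "is")
  have "\<exists>zs \<upsilon>. step X i (mk xs \<tau>) = mk zs \<upsilon> \<and> cat_cells i (mk xs \<tau>) \<le> c \<and>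
      block_sem X R B c is zs \<upsilon> ys \<tau>' \<and> length zs = R \<and> (\<forall>x\<in>set zs. x \<le> B)"
  proof (cases i)
    case (Cat_Write a b)
    then show ?thesis using Cons.prems
      by (intro exI[of _ xs] exI[of _ "\<tau>(xs ! a := xs ! b \<noteq> 0)"]) (auto simp: mk_def)
  qed (use Cons.prems in \<open>auto simp: work_mk tape_mk set_reg_mk dest!: set_update_subset_insert[THEN subsetD]
        intro!: exI conjI\<close>)
  then obtain zs \<upsilon> where z: "step X i (mk xs \<tau>) = mk zs \<upsilon>" "cat_cells i (mk xs \<tau>) \<le> c"
    "block_sem X R B c is zs \<upsilon> ys \<tau>'" "length zs = R" "\<forall>x\<in>set zs. x \<le> B"
    by blast
  have "run X (R * floorlog 2 B) c (Instr i) (mk xs \<tau>) 1 (mk zs \<upsilon>)"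
    using run_Instr[of "mk xs \<tau>" "R * floorlog 2 B" X i c] z work_bits_mk Cons.prems by metis
  from run_Seq[OF this Cons.IH[OF z(3-5)]] show ?case by (simp add: block_def)
qed

lemma list_update_numeral [simp]: "(x # xs)[numeral k := y] = x # xs[pred_numeral k := y]"
  by (simp add: numeral_eq_Suc)

section \<open>The rotor machine\<close>

text \<open>Field \<open>v\<close> occupies \<open>b\<close> consecutive cells from
  \<open>v * b\<close> on, least significant bit first; cells beyond all fields keep
  \<open>\<tau>\<close>.\<close>

definition enc :: "nat \<Rightarrow> nat \<Rightarrow> (nat \<Rightarrow> bool) \<Rightarrow> (nat \<Rightarrow> nat) \<Rightarrow> nat \<Rightarrow> bool" where
  "enc n b \<tau> g j = (if j < n * b then bit (g (j div b)) (j mod b) else \<tau> j)"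

lemma field_address_less:
  fixes v n b i :: nat
  assumes "v < n" "i < b"
  shows "v * b + i < n * b"
proof -
  have "v * b + i < Suc v * b" using assms by simp
  also have "\<dots> \<le> n * b" using assms by (intro mult_le_mono1) simp
  finally show ?thesis .
qed

lemma enc_field: "v < n \<Longrightarrow> i < b \<Longrightarrow> enc n b \<tau> g (v * b + i) = bit (g v) i"
  by (simp add: enc_def field_address_less)

text \<open>This is what the power of two buys: any tape decodes to legal counters, so no initial
  content is exceptional.\<close>

lemma ex_enc: "\<exists>g. (\<forall>v. g v < 2 ^ b) \<and> enc n b \<tau> g = \<tau>"
proof (intro exI conjI allI)
  define g :: "nat \<Rightarrow> nat" where
    "g v = horner_sum of_bool 2 (map (\<lambda>i. \<tau> (v * b + i)) [0..<b])" for v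
  show "g v < 2 ^ b" for v
    unfolding g_def using horner_sum_of_bool_2_less[of "map (\<lambda>i. \<tau> (v * b + i)) [0..<b]"] by simp
  show "enc n b \<tau> g = \<tau>"
  proof
    fix j
    show "enc n b \<tau> g j = \<tau> j"
    proof (cases "j < n * b")
      case True
      then have "b > 0" by (cases b) auto
      with True show ?thesis
        by (simp add: enc_def g_def bit_horner_sum_bit_iff)
    qed (simp add: enc_def)
  qed
qed

text \<open>The left side is the tape in the invariant of the write loop after all \<open>b\<close>
  bits.\<close>

lemma enc_update:
  assumes "v < n"
  shows "(\<lambda>j. if v * b \<le> j \<and> j < v * b + b then bit x (j - v * b) else enc n b \<tau> g j)
    = enc n b \<tau> (g(v := x))"
proof
  fix j
  show "(if v * b \<le> j \<and> j < v * b + b then bit x (j - v * b) else enc n b \<tau> g j)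
    = enc n b \<tau> (g(v := x)) j"
  proof (cases "v * b \<le> j \<and> j < v * b + b")
    case True
    then obtain i where "j = v * b + i" "i < b" by (metis le_Suc_ex nat_add_left_cancel_less)
    then show ?thesis using enc_field[OF assms, of i b \<tau> "g(v := x)"] by simp
  next
    case False
    have "j div b \<noteq> v" if "j < n * b"
    proof
      assume "j div b = v"
      moreover have "b > 0" using that by (cases b) auto
      then have "j div b * b \<le> j" "j < j div b * b + b"
        using div_mult_mod_eq[of j b] mod_less_divisor[of b j] by linarith+
      ultimately show False using False by simp
    qed
    with False show ?thesis by (auto simp: enc_def)
  qed
qed

text \<open>Registers: 0 hits of the first phase; 1 \<open>K = 2 ^ b\<close>; 2 \<open>n\<close>; 3 \<open>b\<close>; 4 \<open>3 (m + 1)\<close>; 5 chips left;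
  6 current vertex; 7 its out-degree; 8 its field; 9 catalytic address; 10 bits left; 11 scratch;
  12 the constant 1; 13 arc index or flag; 14 increment \<open>\<delta>\<close>; 15 offset \<open>e\<close>, added before the arc
  index is taken; 16 hits of the current phase. A forward phase has \<open>\<delta> = 1\<close>, \<open>e = 0\<close>, a backward
  phase \<open>\<delta> = e = K - 1\<close>. Scratch registers are reset to 0, so that states are determined exactly.\<close>

definition step_prog :: program where
  "step_prog =
    Seq (block [Const 8 0, Arith Plus 9 6 12, Arith Times 9 9 3, Arith Plus 10 3 8])
   (Seq (Loop 10 (block [Arith Monus 10 10 12, Arith Monus 9 9 12, Cat_Read 11 9,
           Arith Plus 8 8 8, Arith Plus 8 8 11, Const 11 0]))
   (Seq (block [Arith Plus 11 8 15, Arith Remainder 11 11 1, Arith Remainder 13 11 7,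
           Arith Plus 8 8 14, Arith Remainder 8 8 1, Arith Plus 10 10 3, Const 11 0])
   (Seq (Loop 10 (block [Arith Monus 10 10 12, Arith Plus 11 12 12, Arith Remainder 11 8 11,
           Cat_Write 9 11, Arith Plus 11 12 12, Arith Quotient 8 8 11, Arith Plus 9 9 12,
           Const 11 0]))
   (block [Const 9 0, Out_Neighbour 6 6 13, Const 13 0, Out_Degree 7 6]))))"

text \<open>Lacking a copy instruction, register 5 receives \<open>K\<close> by addition to
  0.\<close>

definition phase_prog :: program where
  "phase_prog =
    Seq (block [Arith Plus 5 5 1])
   (Loop 5
     (Seq (block [Arith Monus 5 5 12, Get_Source 6, Out_Degree 7 6])
     (Seq (Loop 7 step_prog)
     (block [Get_Target 9, Arith Monus 11 9 6, Arith Monus 13 6 9, Arith Plus 11 11 13,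
        Arith Monus 11 12 11, Arith Plus 16 16 11, Const 6 0, Const 9 0, Const 11 0, Const 13 0]))))"

text \<open>The test \<open>\<epsilon> \<ge> 1\<close> must precede any look at \<open>n\<close>:
  for huge \<open>\<epsilon>\<close> the bounds allow neither storing \<open>n\<close> nor scanning
  the vertices. The answer is then 0 / 1.\<close>

definition main_prog :: program where
  "main_prog =
    Seq (block [Const 12 1, Const 1 1, Accuracy_Ge 13 1 1])
   (Cond 13 Skip
     (Seq (block [Get_Num_Verts 2, Arith Plus 5 5 2, Const 4 1])
     (Seq (Loop 5 (block [Arith Monus 5 5 12, Out_Degree 7 5, Arith Plus 4 4 7, Const 7 0]))
     (Seq (block [Const 7 3, Arith Times 4 4 7, Const 7 0, Const 13 1])
     (Seq (Loop 13 (block [Arith Plus 1 1 1, Arith Plus 3 3 12, Accuracy_Ge 13 4 1,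
             Arith Monus 13 12 13]))
     (Seq (block [Const 14 1])
     (Seq phase_prog
     (Seq (block [Arith Plus 0 0 16, Const 16 0, Arith Monus 14 1 12, Arith Monus 15 1 12])
     phase_prog))))))))"

text \<open>\<open>B\<close> bounds all register contents: addresses are at most
  \<open>n * b\<close>, and sums of two field-sized numbers stay below
  \<open>2 * 2 ^ b\<close>.\<close>

locale rotor_machine = dag +
  fixes b c B :: nat
  assumes b_pos: "b \<ge> 1"
    and cells: "num_verts X * b \<le> c"
    and B: "2 * num_verts X * 2 ^ b \<le> B"
begin

abbreviation "n \<equiv> num_verts X"
abbreviation "run' \<equiv> run X (17 * floorlog 2 B) c"

abbreviation state where
  "state h\<^sub>1 M j v d x a i y z \<delta> e h \<equiv> mk [h\<^sub>1, 2 ^ b, n, b, M, j, v, d, x, a, i, y, 1, z, \<delta>, e, h]"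

lemma n_pos: "n \<ge> 1"
  using source by simp

lemma mult_le_B: "k \<le> n \<Longrightarrow> x \<le> 2 * 2 ^ b \<Longrightarrow> k * x \<le> B"
  using mult_le_mono[of k n x "2 * 2 ^ b"] B by (simp add: mult.assoc mult.left_commute)

lemma small_le_B: "x \<le> 2 * 2 ^ b \<Longrightarrow> x \<le> B"
  using mult_le_B[of 1 x] n_pos by simp

lemma one_le_B: "1 \<le> B" "Suc 0 \<le> B" "2 \<le> B"
  using small_le_B[of 1] small_le_B[of 2] by simp_all

lemma n_le_B: "n \<le> B"
  using mult_le_B[of n 1] by simp

lemma b_le_B: "b \<le> B"
  using small_le_B[of b] less_exp[of b] by simp

lemma addr_le_B: "v < n \<Longrightarrow> a \<le> Suc v * b \<Longrightarrow> a \<le> B"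
  using mult_le_B[of "Suc v" b] less_exp[of b] by simp

definition deg :: "nat \<Rightarrow> nat" where
  "deg v = query_degree n (out_list X) v"

lemma deg_le: "deg v \<le> n"
proof (cases "v < n")
  case True
  then have "length (out_list X v) = card (E `` {v})"
    using distinct_card[OF out_list(1)] out_list(2) by simp
  also have "\<dots> \<le> card V" using arcs by (intro card_mono) auto
  finally show ?thesis using True by (simp add: deg_def query_degree_def)
qed (simp add: deg_def query_degree_def)

lemma deg_eq: "v < n \<Longrightarrow> deg v = length (out_list X v)"
  by (simp add: deg_def query_degree_def)

lemma deg_eq_0_iff: "v < n \<Longrightarrow> deg v = 0 \<longleftrightarrow> is_sink E v"
  by (simp add: deg_eq is_sink_iff_out_list)

lemma deg_le_B: "deg v \<le> B"
  using deg_le n_le_B by (rule order.trans)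

lemma run'_block:
  assumes "block_sem X 17 B c is xs \<tau> ys \<tau>'" "length xs = 17" "\<forall>x\<in>set xs. x \<le> B" "T = Suc (length is)"
  shows "run' (block is) (mk xs \<tau>) T (mk ys \<tau>')"
  using run_block[OF assms(1-3)] assms(4) by simp

section \<open>One rotor step: reading, updating and writing a field\<close>

context
  fixes h\<^sub>1 M j \<delta> e h v :: nat and \<tau> :: "nat \<Rightarrow> bool" and g :: "nat \<Rightarrow> nat"
  assumes bounds: "h\<^sub>1 \<le> B" "M \<le> B" "j \<le> B" "\<delta> < 2 ^ b" "e < 2 ^ b" "h \<le> B"
    and g: "\<And>v. g v < 2 ^ b"
    and v: "v < n" "\<not> is_sink E v"
begin

lemma delta_e_v_le_B: "\<delta> \<le> B" "e \<le> B" "v \<le> B"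
  using bounds small_le_B v(1) n_le_B by simp_all

lemmas le_B = bounds(1-3,6) delta_e_v_le_B one_le_B n_le_B b_le_B deg_le_B small_le_B

lemma run_read:
  "run' (Loop 10 (block [Arith Monus 10 10 12, Arith Monus 9 9 12, Cat_Read 11 9,
           Arith Plus 8 8 8, Arith Plus 8 8 11, Const 11 0]))
    (state h\<^sub>1 M j v (deg v) 0 (Suc v * b) b 0 0 \<delta> e h (enc n b \<tau> g)) (b * 8 + 1)
    (state h\<^sub>1 M j v (deg v) (g v) (v * b) 0 0 0 \<delta> e h (enc n b \<tau> g))"
proof -
  \<comment> \<open>Horner's rule from the top bit down: after \<open>i\<close> rounds the
    \<open>b - i\<close> low bits of the field are still missing.\<close>
  define S where "S i = state h\<^sub>1 M j v (deg v) (g v div 2 ^ (b - i)) (Suc v * b - i) (b - i) 0 0 \<delta> e h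
    (enc n b \<tau> g)" for i
  have quot: "g v div 2 ^ k \<le> B" for k
    using g[of v] div_le_dividend[of "g v" "2 ^ k"] by (intro small_le_B) linarith
  have body: "run' (block [Arith Monus 10 10 12, Arith Monus 9 9 12, Cat_Read 11 9,
           Arith Plus 8 8 8, Arith Plus 8 8 11, Const 11 0]) (S i) 7 (S (Suc i))" if "i < b" for i
  proof -
    define k where "k = b - Suc i"
    have k: "b - i = Suc k" "k < b" using that by (auto simp: k_def)
    have addr: "Suc v * b - i = Suc (v * b + k)" "Suc v * b - Suc i = v * b + k"
      using that by (auto simp: k_def)
    have x: "2 * (g v div 2 ^ Suc k) + of_bool (bit (g v) k) = g v div 2 ^ k"
    proof -
      have "g v div 2 ^ Suc k = g v div 2 ^ k div 2" by (simp only: power_Suc2 div_mult2_eq)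
      then show ?thesis by (simp add: bit_iff_odd mult_div_mod_eq flip: mod_2_eq_odd)
    qed
    have "v * b + k < c" using field_address_less[OF v(1) k(2)] cells by simp
    moreover have "Suc (v * b + k) \<le> B" by (rule addr_le_B[OF v(1)]) (use k in simp)
    moreover have "Suc k \<le> B" using b_le_B k by simp
    moreover define y where "y = g v div 2 ^ Suc k"
    moreover have "g v div 2 ^ k = y + y + of_bool (enc n b \<tau> g (v * b + k))"
      using x v k by (simp add: enc_field y_def)
    ultimately show ?thesis
      unfolding S_def k addr k_def[symmetric]
      using v quot[of k] quot[of "Suc k"]
      by (intro run'_block) (simp_all add: le_B del: power_Suc)
  qed
  have "run' (Loop 10 (block [Arith Monus 10 10 12, Arith Monus 9 9 12, Cat_Read 11 9,
           Arith Plus 8 8 8, Arith Plus 8 8 11, Const 11 0])) (S 0) (b * Suc 7 + 1) (S b)"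
  proof (rule run_Loop[where S = S, OF _ body])
    have "v * b \<le> B" by (rule addr_le_B[OF v(1)]) simp
    then show "work_bits (S b) \<le> 17 * floorlog 2 B"
      unfolding S_def using quot[of 0] by (intro work_bits_mk) (auto simp: le_B)
  qed (auto simp: S_def work_mk)
  moreover have "S 0 = state h\<^sub>1 M j v (deg v) 0 (Suc v * b) b 0 0 \<delta> e h (enc n b \<tau> g)"
    "S b = state h\<^sub>1 M j v (deg v) (g v) (v * b) 0 0 0 \<delta> e h (enc n b \<tau> g)"
    using g[of v] by (simp_all add: S_def)
  ultimately show ?thesis by simp
qed

lemma run_write:
  assumes "x < 2 ^ b" "z \<le> B"
  shows "run' (Loop 10 (block [Arith Monus 10 10 12, Arith Plus 11 12 12, Arith Remainder 11 8 11,
           Cat_Write 9 11, Arith Plus 11 12 12, Arith Quotient 8 8 11, Arith Plus 9 9 12,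
           Const 11 0]))
    (state h\<^sub>1 M j v (deg v) x (v * b) b 0 z \<delta> e h (enc n b \<tau> g)) (b * 10 + 1)
    (state h\<^sub>1 M j v (deg v) 0 (Suc v * b) 0 0 z \<delta> e h (enc n b \<tau> (g(v := x))))"
proof -
  \<comment> \<open>Writing goes upwards: the lowest \<open>i\<close> cells of the field already
    hold bits of \<open>x\<close>, and register 8 keeps the remaining quotient.\<close>
  define t where "t i = (\<lambda>j. if v * b \<le> j \<and> j < v * b + i then bit x (j - v * b) else enc n b \<tau> g j)"
    for i
  define S where "S i = state h\<^sub>1 M j v (deg v) (x div 2 ^ i) (v * b + i) (b - i) 0 z \<delta> e h (t i)"
    for i
  have quot: "x div 2 ^ k \<le> B" for k
    using assms(1) div_le_dividend[of x "2 ^ k"] by (intro small_le_B) linarith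
  have body: "run' (block [Arith Monus 10 10 12, Arith Plus 11 12 12, Arith Remainder 11 8 11,
           Cat_Write 9 11, Arith Plus 11 12 12, Arith Quotient 8 8 11, Arith Plus 9 9 12,
           Const 11 0]) (S i) 9 (S (Suc i))" if "i < b" for i
  proof -
    have t: "t (Suc i) = (t i)(v * b + i := odd (x div 2 ^ i))"
      by (auto simp: t_def fun_eq_iff bit_iff_odd less_Suc_eq)
    have q: "x div 2 ^ Suc i = x div 2 ^ i div 2" by (simp only: power_Suc2 div_mult2_eq)
    have "v * b + i < c" using field_address_less[OF v(1) that] cells by simp
    moreover have "v * b + i \<le> B" "Suc (v * b + i) \<le> B"
      by (rule addr_le_B[OF v(1)], use that in simp)+
    moreover have "b - i \<le> B" "b - Suc i \<le> B" using b_le_B by simp_all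
    moreover have "y mod 2 \<le> B" for y
      using one_le_B(3) mod_less_divisor[of 2 y] by linarith
    moreover define y where "y = x div 2 ^ i"
    moreover have "y \<le> B" "y div 2 \<le> B" using quot[of i] quot[of "Suc i"] by (simp_all only: y_def q)
    moreover have "0 < y mod 2 \<longleftrightarrow> odd y" by (simp add: odd_iff_mod_2_eq_one)
    moreover have "b - i - 1 = b - Suc i" by simp
    moreover have "1 + 1 = (2::nat)" by simp
    ultimately show ?thesis
      unfolding S_def t q y_def[symmetric]
      using assms(2) v
      by (intro run'_block) (simp_all add: le_B numeral_2_eq_2[symmetric] del: power_Suc)
  qed
  have "run' (Loop 10 (block [Arith Monus 10 10 12, Arith Plus 11 12 12, Arith Remainder 11 8 11,
           Cat_Write 9 11, Arith Plus 11 12 12, Arith Quotient 8 8 11, Arith Plus 9 9 12,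
           Const 11 0])) (S 0) (b * Suc 9 + 1) (S b)"
  proof (rule run_Loop[where S = S, OF _ body])
    have "v * b + b \<le> B" by (rule addr_le_B[OF v(1)]) simp
    then show "work_bits (S b) \<le> 17 * floorlog 2 B"
      unfolding S_def using quot[of b] assms(2) by (intro work_bits_mk) (auto simp: le_B)
  qed (auto simp: S_def work_mk)
  moreover have "t 0 = enc n b \<tau> g" by (auto simp: t_def fun_eq_iff)
  then have "S 0 = state h\<^sub>1 M j v (deg v) x (v * b) b 0 z \<delta> e h (enc n b \<tau> g)"
    by (simp add: S_def)
  moreover have "S b = state h\<^sub>1 M j v (deg v) 0 (Suc v * b) 0 0 z \<delta> e h (enc n b \<tau> (g(v := x)))"
    using assms(1) enc_update[OF v(1), of b x \<tau> g] by (simp add: S_def t_def add.commute)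
  ultimately show ?thesis by simp
qed

lemma run_step:
  "run' step_prog
    (state h\<^sub>1 M j v (deg v) 0 0 0 0 0 \<delta> e h (enc n b \<tau> g)) (18 * b + 20)
    (let w = out_list X v ! ((g v + e) mod 2 ^ b mod length (out_list X v)) in
     state h\<^sub>1 M j w (deg w) 0 0 0 0 0 \<delta> e h (enc n b \<tau> (g(v := (g v + \<delta>) mod 2 ^ b))))"
proof -
  define z where "z = (g v + e) mod 2 ^ b mod deg v"
  define w where "w = out_list X v ! z"
  define x where "x = (g v + \<delta>) mod 2 ^ b"
  have deg: "deg v > 0" using v(2) deg_eq_0_iff[OF v(1)] by simp
  have z: "z < deg v" using deg by (simp add: z_def)
  have z': "z < length (out_list X v)" using z deg_eq[OF v(1)] by simp
  then have "w \<in> set (out_list X v)" by (simp add: w_def)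
  then have w: "w < n" using out_list(2)[of v] v arcs by auto
  have q: "query_neighbour n (out_list X) v z = w" "query_degree n (out_list X) w = deg w"
    using z' v by (simp_all add: query_neighbour_def w_def deg_def)
  have zB: "z \<le> B" using z deg_le_B[of v] by simp
  have vB: "v \<le> B" "w \<le> B" "Suc v \<le> B" using v w n_le_B by simp_all
  have aB: "v * b \<le> B" "Suc v * b \<le> B" using addr_le_B[OF v(1)] by simp_all
  have xB: "x < 2 ^ b" by (simp add: x_def)
  have modB: "(g v + e) mod 2 ^ b \<le> B" "x \<le> B"
    using small_le_B by (simp_all add: less_imp_le trans_le_add1 x_def mult_2)
  have sumB: "g v \<le> B" "g v + e \<le> B" "g v + \<delta> \<le> B"
    using g[of v] bounds by (intro small_le_B; simp)+
  have "run' step_prog (state h\<^sub>1 M j v (deg v) 0 0 0 0 0 \<delta> e h (enc n b \<tau> g))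
      (5 + ((b * 8 + 1) + (8 + ((b * 10 + 1) + 5))))
      (state h\<^sub>1 M j w (deg w) 0 0 0 0 0 \<delta> e h (enc n b \<tau> (g(v := x))))"
    unfolding step_prog_def
  proof (intro run_Seq)
    show "run' (block [Const 8 0, Arith Plus 9 6 12, Arith Times 9 9 3, Arith Plus 10 3 8])
        (state h\<^sub>1 M j v (deg v) 0 0 0 0 0 \<delta> e h (enc n b \<tau> g)) 5
        (state h\<^sub>1 M j v (deg v) 0 (Suc v * b) b 0 0 \<delta> e h (enc n b \<tau> g))"
      using vB aB by (intro run'_block) (simp_all add: le_B)
    show "run' (block [Arith Plus 11 8 15, Arith Remainder 11 11 1, Arith Remainder 13 11 7,
           Arith Plus 8 8 14, Arith Remainder 8 8 1, Arith Plus 10 10 3, Const 11 0])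
        (state h\<^sub>1 M j v (deg v) (g v) (v * b) 0 0 0 \<delta> e h (enc n b \<tau> g)) 8
        (state h\<^sub>1 M j v (deg v) x (v * b) b 0 z \<delta> e h (enc n b \<tau> g))"
      using vB aB sumB modB zB by (intro run'_block) (simp_all add: le_B z_def x_def)
    show "run' (block [Const 9 0, Out_Neighbour 6 6 13, Const 13 0, Out_Degree 7 6])
        (state h\<^sub>1 M j v (deg v) 0 (Suc v * b) 0 0 z \<delta> e h (enc n b \<tau> (g(v := x)))) 5
        (state h\<^sub>1 M j w (deg w) 0 0 0 0 0 \<delta> e h (enc n b \<tau> (g(v := x))))"
      using vB aB zB by (intro run'_block) (simp_all add: le_B q)
  qed (use run_read run_write[OF xB zB] in simp_all)
  then show ?thesis
    unfolding Let_def deg_eq[OF v(1), symmetric] z_def[symmetric] w_def[symmetric] x_def[symmetric]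
    by (rule run_mono) simp
qed

end

abbreviation counters :: "nat \<Rightarrow> (nat \<Rightarrow> nat) \<Rightarrow> (nat \<Rightarrow> nat) \<Rightarrow> nat \<Rightarrow> nat" where
  "counters \<delta> g u \<equiv> \<lambda>v. (g v + u v * \<delta>) mod 2 ^ b"

section \<open>From steps to walks and phases\<close>

context
  fixes h\<^sub>1 M \<delta> e :: nat and \<tau> :: "nat \<Rightarrow> bool" and g :: "nat \<Rightarrow> nat"
  assumes bounds: "h\<^sub>1 \<le> B" "M \<le> B" "\<delta> < 2 ^ b" "e < 2 ^ b"
begin

lemma bounds_le_B: "h\<^sub>1 \<le> B" "M \<le> B" "\<delta> \<le> B" "e \<le> B"
  using bounds small_le_B by simp_all

lemmas le_B' = bounds_le_B one_le_B n_le_B b_le_B deg_le_B small_le_B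

text \<open>The loop test is the out-degree in register 7, which is 0 exactly at sinks. Ending at a
  sink within the fuel \<open>l\<close> therefore means that the loop halts within \<open>l\<close>
  rounds.\<close>

lemma run_walk:
  assumes "v < n" "j \<le> B" "h \<le> B"
    and "is_sink E (snd (route E (exit X (2 ^ b) \<delta> e g) l u v))"
  shows "run' (Loop 7 step_prog)
    (state h\<^sub>1 M j v (deg v) 0 0 0 0 0 \<delta> e h (enc n b \<tau> (counters \<delta> g u))) (l * (18 * b + 21) + 1)
    (case route E (exit X (2 ^ b) \<delta> e g) l u v of (u', w) \<Rightarrow>
      state h\<^sub>1 M j w (deg w) 0 0 0 0 0 \<delta> e h (enc n b \<tau> (counters \<delta> g u')))"
  using assms(1,4)
proof (induction l arbitrary: u v)
  case 0
  have "v \<le> B" using 0 n_le_B by simp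
  then have "run' (Loop 7 step_prog)
    (state h\<^sub>1 M j v (deg v) 0 0 0 0 0 \<delta> e h (enc n b \<tau> (counters \<delta> g u))) 1
    (state h\<^sub>1 M j v (deg v) 0 0 0 0 0 \<delta> e h (enc n b \<tau> (counters \<delta> g u)))"
    using 0 assms(2,3)
    by (intro run_Loop_False work_bits_mk) (simp_all add: le_B' work_mk deg_eq_0_iff)
  then show ?case by simp
next
  case (Suc l)
  have vB: "v \<le> B" using Suc.prems n_le_B by simp
  show ?case
  proof (cases "is_sink E v")
    case True
    then have r: "run' (Loop 7 step_prog)
      (state h\<^sub>1 M j v (deg v) 0 0 0 0 0 \<delta> e h (enc n b \<tau> (counters \<delta> g u))) 1
      (state h\<^sub>1 M j v (deg v) 0 0 0 0 0 \<delta> e h (enc n b \<tau> (counters \<delta> g u)))"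
      using vB Suc.prems assms(2,3)
      by (intro run_Loop_False work_bits_mk) (simp_all add: le_B' work_mk deg_eq_0_iff)
    show ?thesis using True run_mono[OF r, of "Suc l * (18 * b + 21) + 1"] by simp
  next
    case False
    interpret R: rotor V E "exit X (2 ^ b) \<delta> e g" by (rule rotor_exit)
    define w where "w = exit X (2 ^ b) \<delta> e g v (u v)"
    define u' where "u' = u(v := Suc (u v))"
    have w: "w < n" using R.nb[OF False] arcs by (auto simp: w_def)
    have "(counters \<delta> g u)(v := (counters \<delta> g u v + \<delta>) mod 2 ^ b) = counters \<delta> g u'"
      by (auto simp: u'_def fun_eq_iff mod_simps algebra_simps)
    moreover have "out_list X v ! ((counters \<delta> g u v + e) mod 2 ^ b mod length (out_list X v)) = w"
      by (simp add: w_def exit_def mod_simps)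
    ultimately have "run' step_prog
      (state h\<^sub>1 M j v (deg v) 0 0 0 0 0 \<delta> e h (enc n b \<tau> (counters \<delta> g u))) (18 * b + 20)
      (state h\<^sub>1 M j w (deg w) 0 0 0 0 0 \<delta> e h (enc n b \<tau> (counters \<delta> g u')))"
      using run_step[of h\<^sub>1 M j \<delta> e h "counters \<delta> g u" v \<tau>] bounds assms(2,3) Suc.prems(1) False
      by (simp add: Let_def)
    moreover have r: "route E (exit X (2 ^ b) \<delta> e g) (Suc l) u v =
        route E (exit X (2 ^ b) \<delta> e g) l u' w"
      using False by (simp add: u'_def w_def)
    moreover have "run' (Loop 7 step_prog)
      (state h\<^sub>1 M j w (deg w) 0 0 0 0 0 \<delta> e h (enc n b \<tau> (counters \<delta> g u'))) (l * (18 * b + 21) + 1)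
      (case route E (exit X (2 ^ b) \<delta> e g) l u' w of (u', w) \<Rightarrow>
        state h\<^sub>1 M j w (deg w) 0 0 0 0 0 \<delta> e h (enc n b \<tau> (counters \<delta> g u')))"
      using w Suc.prems(2) r by (intro Suc.IH) simp_all
    moreover have "work (state h\<^sub>1 M j v (deg v) 0 0 0 0 0 \<delta> e h
        (enc n b \<tau> (counters \<delta> g u))) 7 \<noteq> 0"
      using deg_eq_0_iff[OF Suc.prems(1)] False by (simp add: work_mk)
    ultimately show ?thesis
      unfolding r by - (rule run_mono[OF run_Loop_True], assumption+, simp add: algebra_simps)
  qed
qed

lemma run_phase:
  assumes "chips E (exit X (2 ^ b) \<delta> e g) n (source X) (2 ^ b) = (u, ends)"
    and "\<And>v. g v < 2 ^ b"
  shows "run' phase_prog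
    (state h\<^sub>1 M 0 0 0 0 0 0 0 0 \<delta> e 0 (enc n b \<tau> g)) (2 ^ b * (n * (18 * b + 21) + 17) + 3)
    (state h\<^sub>1 M 0 0 0 0 0 0 0 0 \<delta> e (count_list ends (target X)) (enc n b \<tau> (counters \<delta> g u)))"
proof -
  let ?nb = "exit X (2 ^ b) \<delta> e g" and ?s = "source X" and ?t = "target X"
  interpret R: rotor V E ?nb by (rule rotor_exit)
  have s: "?s \<in> V" using source by simp
  have sB: "?s \<le> B" "?t \<le> B" using source target n_le_B by simp_all
  define S where "S j = (case chips E ?nb n ?s j of (u, ends) \<Rightarrow>
      state h\<^sub>1 M (2 ^ b - j) 0 0 0 0 0 0 0 \<delta> e (count_list ends ?t) (enc n b \<tau> (counters \<delta> g u)))"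
    for j
  let ?body = "Seq (block [Arith Monus 5 5 12, Get_Source 6, Out_Degree 7 6])
     (Seq (Loop 7 step_prog)
     (block [Get_Target 9, Arith Monus 11 9 6, Arith Monus 13 6 9, Arith Plus 11 11 13,
        Arith Monus 11 12 11, Arith Plus 16 16 11, Const 6 0, Const 9 0, Const 11 0, Const 13 0]))"
  have body: "run' ?body (S j) (n * (18 * b + 21) + 16) (S (Suc j))" if j: "j < 2 ^ b" for j
  proof -
    obtain u ends where c: "chips E ?nb n ?s j = (u, ends)" by fastforce
    obtain u' w where r: "route E ?nb n u ?s = (u', w)" by fastforce
    have "length ends = j" using R.chips_balance(2)[of ?s j u ends] s c by simp
    then have cnt: "count_list ends ?t \<le> j" using count_le_length[of ends ?t] by simp
    have hB: "count_list ends ?t \<le> B" "Suc (count_list ends ?t) \<le> B"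
      using cnt j by (intro small_le_B; simp)+
    have jB: "2 ^ b - j \<le> B" "2 ^ b - Suc j \<le> B" by (intro small_le_B; simp)+
    have w: "w < n" "is_sink E w"
      using R.route_drift(1)[OF s r] R.route_card_sink[of u ?s] r by simp_all
    have wB: "w \<le> B" using w n_le_B by simp
    have "run' ?body (S j) (4 + ((n * (18 * b + 21) + 1) + 11)) (S (Suc j))"
    proof (intro run_Seq)
      show "run' (block [Arith Monus 5 5 12, Get_Source 6, Out_Degree 7 6]) (S j) 4
          (state h\<^sub>1 M (2 ^ b - Suc j) ?s (deg ?s) 0 0 0 0 0 \<delta> e (count_list ends ?t)
            (enc n b \<tau> (counters \<delta> g u)))"
        unfolding S_def c prod.case using sB hB jB
        by (intro run'_block) (simp_all add: le_B' flip: deg_def)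
      show "run' (Loop 7 step_prog)
          (state h\<^sub>1 M (2 ^ b - Suc j) ?s (deg ?s) 0 0 0 0 0 \<delta> e (count_list ends ?t)
            (enc n b \<tau> (counters \<delta> g u))) (n * (18 * b + 21) + 1)
          (state h\<^sub>1 M (2 ^ b - Suc j) w 0 0 0 0 0 0 \<delta> e (count_list ends ?t)
            (enc n b \<tau> (counters \<delta> g u')))"
        using run_walk[of ?s "2 ^ b - Suc j" "count_list ends ?t" n u] source jB hB r w
          deg_eq_0_iff[OF w(1)] by simp
      \<comment> \<open>Equality test by truncated subtraction: the inner sum is the distance of
        \<open>w\<close> and \<open>?t\<close>.\<close>
      have "1 - ((?t - w) + (w - ?t)) = (of_bool (w = ?t) :: nat)" by (simp add: of_bool_def)
      then show "run' (block [Get_Target 9, Arith Monus 11 9 6, Arith Monus 13 6 9, Arith Plus 11 11 13,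
          Arith Monus 11 12 11, Arith Plus 16 16 11, Const 6 0, Const 9 0, Const 11 0, Const 13 0])
          (state h\<^sub>1 M (2 ^ b - Suc j) w 0 0 0 0 0 0 \<delta> e (count_list ends ?t)
            (enc n b \<tau> (counters \<delta> g u'))) 11 (S (Suc j))"
        unfolding S_def chips.simps c r prod.case using sB wB hB jB
        by (intro run'_block) (auto simp: le_B')
    qed
    then show ?thesis by (rule run_mono) simp
  qed
  have "length ends = 2 ^ b" using R.chips_balance(2)[of ?s "2 ^ b" u ends] s assms(1) by simp
  then have cnt: "count_list ends ?t \<le> B"
    using count_le_length[of ends ?t] by (intro small_le_B) simp
  have "run' (Loop 5 ?body) (S 0) (2 ^ b * Suc (n * (18 * b + 21) + 16) + 1) (S (2 ^ b))"
  proof (rule run_Loop[where S = S, OF _ body])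
    show "work_bits (S (2 ^ b)) \<le> 17 * floorlog 2 B"
      unfolding S_def assms(1) prod.case using cnt
      by (intro work_bits_mk) (simp_all add: le_B')
  qed (auto simp: S_def work_mk split: prod.splits)
  moreover have "run' (block [Arith Plus 5 5 1]) (state h\<^sub>1 M 0 0 0 0 0 0 0 0 \<delta> e 0 (enc n b \<tau> g)) 2 (S 0)"
    unfolding S_def chips.simps prod.case using assms(2)
    by (intro run'_block) (simp_all add: le_B')
  ultimately have "run' phase_prog (state h\<^sub>1 M 0 0 0 0 0 0 0 0 \<delta> e 0 (enc n b \<tau> g))
     (2 + (2 ^ b * Suc (n * (18 * b + 21) + 16) + 1)) (S (2 ^ b))"
    unfolding phase_prog_def by (intro run_Seq)
  moreover have "S (2 ^ b) = state h\<^sub>1 M 0 0 0 0 0 0 0 0 \<delta> e (count_list ends ?t)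
      (enc n b \<tau> (counters \<delta> g u))"
    by (simp add: S_def assms(1))
  ultimately show ?thesis by (simp add: run_mono)
qed

end

text \<open>The equivalence assumed of \<open>b\<close> says what the doubling loop observes: its
  flag stays set exactly while \<open>i < b\<close>. Restoration does not depend on the target being
  a sink, only the accuracy does.\<close>

lemma run_main:
  assumes small: "accuracy X < 1"
    and b: "\<And>i. 3 * real (card E + 1) \<le> 2 ^ i * accuracy X \<longleftrightarrow> b \<le> i"
  shows "\<exists>\<sigma>. run' main_prog (initial \<tau>) (200 * n * b * 2 ^ b) \<sigma> \<and> tape \<sigma> = \<tau> \<and>
    work \<sigma> 1 = 2 ^ b \<and>
    (is_sink E (target X) \<longrightarrow>
      \<bar>real (work \<sigma> 0) - 2 ^ b * reach_prob E (source X) (target X)\<bar> \<le> 3 * card E)"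
proof -
  define m where "m = card E"
  obtain g where g: "\<And>v. g v < 2 ^ b" and enc: "enc n b \<tau> g = \<tau>" using ex_enc by blast
  obtain u ends where c: "chips E (exit X (2 ^ b) 1 0 g) n (source X) (2 ^ b) = (u, ends)"
    by fastforce
  define g' where "g' = (\<lambda>v. (g v + u v) mod 2 ^ b)"
  obtain u' ends' where
    c': "chips E (exit X (2 ^ b) (2 ^ b - 1) (2 ^ b - 1) g') n (source X) (2 ^ b) = (u', ends')"
    by fastforce
  have s: "source X \<in> V" using source by simp
  interpret R: rotor V E "exit X (2 ^ b) 1 0 g" by (rule rotor_exit)
  interpret R': rotor V E "exit X (2 ^ b) (2 ^ b - 1) (2 ^ b - 1) g'" by (rule rotor_exit)
  define H where "H = count_list ends (target X)"
  define H' where "H' = count_list ends' (target X)"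
  have "H \<le> 2 ^ b" "H' \<le> 2 ^ b"
    using count_le_length[of ends "target X"] count_le_length[of ends' "target X"]
      R.chips_balance(2)[OF s, of "2 ^ b"] R'.chips_balance(2)[OF s, of "2 ^ b"] c c'
    by (simp_all add: H_def H'_def)
  then have HB: "H \<le> B" "H' \<le> B" by (simp_all add: small_le_B)
  have "real (3 * (m + 1)) \<le> 2 ^ b * accuracy X" using b[of b] by (simp add: m_def)
  also have "\<dots> \<le> 2 ^ b" using small by (simp add: mult_left_le)
  finally have m: "3 * (m + 1) \<le> 2 ^ b"
    by (metis of_nat_le_iff of_nat_numeral of_nat_power)
  have mB: "3 + 3 * m \<le> B" "Suc m \<le> B" using m by (intro small_le_B; simp)+
  have powB: "2 ^ i \<le> B" "2 * 2 ^ i \<le> B" if "i \<le> b" for i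
    using power_increasing[OF that, of "2::nat"] small_le_B[of "2 ^ i"] small_le_B[of "2 * 2 ^ i"]
    by simp_all

  \<comment> \<open>Register 5 is both loop counter and vertex, so degrees are summed downwards from
    \<open>n - 1\<close>.\<close>
  have "(\<Sum>k<n. deg (n - Suc k)) = (\<Sum>v<n. deg v)" by (rule sum.nat_diff_reindex)
  also have "\<dots> = m" using sum_out_degree by (simp add: deg_eq m_def)
  finally have sum_deg: "(\<Sum>k<n. deg (n - Suc k)) = m" .
  define D where "D i = mk [0, 1, n, 0, Suc (\<Sum>k<i. deg (n - Suc k)), n - i, 0, 0, 0, 0, 0, 0, 1, 0, 0, 0, 0] \<tau>"
    for i
  have sum_le: "Suc (\<Sum>k<i. deg (n - Suc k)) \<le> B" if "i \<le> n" for i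
  proof -
    have "(\<Sum>k<i. deg (n - Suc k)) \<le> (\<Sum>k<n. deg (n - Suc k))"
      using that by (intro sum_mono2) auto
    then show ?thesis using mB sum_deg by simp
  qed
  have degrees: "run' (Loop 5 (block [Arith Monus 5 5 12, Out_Degree 7 5, Arith Plus 4 4 7, Const 7 0]))
      (D 0) (n * Suc 5 + 1) (D n)"
  proof (rule run_Loop[where S = D])
    fix i assume i: "i < n"
    have "n - i \<le> B" "n - Suc i \<le> B" "n - i - 1 = n - Suc i" using n_le_B by simp_all
    then show "run' (block [Arith Monus 5 5 12, Out_Degree 7 5, Arith Plus 4 4 7, Const 7 0])
        (D i) 5 (D (Suc i))"
      unfolding D_def using sum_le[of i] sum_le[of "Suc i"] i
      by (intro run'_block) (simp_all add: one_le_B n_le_B deg_le_B flip: deg_def)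
  qed (use sum_le[of n] in \<open>auto simp: D_def work_mk one_le_B n_le_B intro!: work_bits_mk\<close>)
  have Dn: "D n = mk [0, 1, n, 0, Suc m, 0, 0, 0, 0, 0, 0, 0, 1, 0, 0, 0, 0] \<tau>"
    by (simp add: D_def sum_deg)

  define L where "L i = mk [0, 2 ^ i, n, i, 3 + 3 * m, 0, 0, 0, 0, 0, 0, 0, 1, of_bool (i < b), 0, 0, 0] \<tau>"
    for i
  have scale: "run' (Loop 13 (block [Arith Plus 1 1 1, Arith Plus 3 3 12, Accuracy_Ge 13 4 1,
      Arith Monus 13 12 13])) (L 0) (b * Suc 5 + 1) (L b)"
  proof (rule run_Loop[where S = L])
    fix i assume i: "i < b"
    have "3 + 3 * real m \<le> 2 * 2 ^ i * accuracy X \<longleftrightarrow> \<not> Suc i < b"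
      using b[of "Suc i"] by (auto simp: m_def)
    moreover have "2 ^ i + 2 ^ i = (2 * 2 ^ i :: nat)" by simp
    ultimately show "run' (block [Arith Plus 1 1 1, Arith Plus 3 3 12, Accuracy_Ge 13 4 1,
      Arith Monus 13 12 13]) (L i) 5 (L (Suc i))"
      unfolding L_def using mB i powB[of i] b_le_B
      by (intro run'_block) (simp_all add: one_le_B n_le_B)
  qed (use mB powB[of b] b_le_B in \<open>auto simp: L_def work_mk one_le_B n_le_B intro!: work_bits_mk\<close>)

  have pos: "(1::nat) < 2 ^ b" "(0::nat) < 2 ^ b" using b_pos one_less_power[of "2::nat" b] by simp_all
  have phase1: "run' phase_prog (state 0 (3 + 3 * m) 0 0 0 0 0 0 0 0 1 0 0 \<tau>)
     (2 ^ b * (n * (18 * b + 21) + 17) + 3) (state 0 (3 + 3 * m) 0 0 0 0 0 0 0 0 1 0 H (enc n b \<tau> g'))"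
    using run_phase[OF _ mB(1) pos c g, of 0 \<tau>] by (simp add: enc H_def g'_def)
  have phase2: "run' phase_prog
     (state H (3 + 3 * m) 0 0 0 0 0 0 0 0 (2 ^ b - 1) (2 ^ b - 1) 0 (enc n b \<tau> g'))
     (2 ^ b * (n * (18 * b + 21) + 17) + 3)
     (state H (3 + 3 * m) 0 0 0 0 0 0 0 0 (2 ^ b - 1) (2 ^ b - 1) H' \<tau>)"
  proof -
    have "counters (2 ^ b - 1) g' u' = g"
      using chips_restore[OF c c'[unfolded g'_def] s g] by (simp add: g'_def)
    moreover have "2 ^ b - 1 < (2 ^ b :: nat)" by simp
    moreover have "g' v < 2 ^ b" for v by (simp add: g'_def)
    ultimately show ?thesis
      using run_phase[OF HB(1) mB(1) _ _ c', of \<tau>] by (simp add: enc H'_def)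
  qed
  define \<sigma> where "\<sigma> = state H (3 + 3 * m) 0 0 0 0 0 0 0 0 (2 ^ b - 1) (2 ^ b - 1) H' \<tau>"
  have init: "initial \<tau> = mk (replicate 17 0) \<tau>"
    by (simp add: initial_def mk_def fun_eq_iff)
  have "run' main_prog (initial \<tau>)
     (4 + Suc (4 + ((n * Suc 5 + 1) + (5 + ((b * Suc 5 + 1) + (2 +
       ((2 ^ b * (n * (18 * b + 21) + 17) + 3) + (5 + (2 ^ b * (n * (18 * b + 21) + 17) + 3)))))))))
     \<sigma>"
    unfolding main_prog_def
  proof (intro run_Seq run_Cond_False)
    show "run' (block [Const 12 1, Const 1 1, Accuracy_Ge 13 1 1]) (initial \<tau>) 4
        (mk [0, 1, 0, 0, 0, 0, 0, 0, 0, 0, 0, 0, 1, 0, 0, 0, 0] \<tau>)"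
      unfolding init using small
      by (intro run'_block) (simp_all add: one_le_B numeral_eq_Suc)
    show "work (mk [0, 1, 0, 0, 0, 0, 0, 0, 0, 0, 0, 0, 1, 0, 0, 0, 0] \<tau>) 13 = 0"
      by (simp add: work_mk)
    show "run' (block [Get_Num_Verts 2, Arith Plus 5 5 2, Const 4 1])
        (mk [0, 1, 0, 0, 0, 0, 0, 0, 0, 0, 0, 0, 1, 0, 0, 0, 0] \<tau>) 4 (D 0)"
      unfolding D_def by (intro run'_block) (simp_all add: one_le_B n_le_B)
    show "run' (block [Const 7 3, Arith Times 4 4 7, Const 7 0, Const 13 1]) (D n) 5 (L 0)"
      unfolding Dn L_def using mB b_pos
      by (intro run'_block) (simp_all add: one_le_B n_le_B)
    show "run' (block [Const 14 1]) (L b) 2 (state 0 (3 + 3 * m) 0 0 0 0 0 0 0 0 1 0 0 \<tau>)"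
      unfolding L_def using mB powB[of b]
      by (intro run'_block) (simp_all add: one_le_B n_le_B b_le_B)
    show "run' (block [Arith Plus 0 0 16, Const 16 0, Arith Monus 14 1 12, Arith Monus 15 1 12])
       (state 0 (3 + 3 * m) 0 0 0 0 0 0 0 0 1 0 H (enc n b \<tau> g')) 5
       (state H (3 + 3 * m) 0 0 0 0 0 0 0 0 (2 ^ b - 1) (2 ^ b - 1) 0 (enc n b \<tau> g'))"
      using mB HB powB[of b] small_le_B[of "2 ^ b - 1"]
      by (intro run'_block) (simp_all add: one_le_B n_le_B b_le_B)
    show "run' phase_prog (state H (3 + 3 * m) 0 0 0 0 0 0 0 0 (2 ^ b - 1) (2 ^ b - 1) 0 (enc n b \<tau> g'))
       (2 ^ b * (n * (18 * b + 21) + 17) + 3) \<sigma>"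
      unfolding \<sigma>_def by (rule phase2)
  qed (fact degrees scale phase1)+
  then have "run' main_prog (initial \<tau>) (200 * n * b * 2 ^ b) \<sigma>"
  proof (rule run_mono)
    \<comment> \<open>Each phase costs at most \<open>56 * P\<close> plus a constant, from 18 + 21 +
      17; the degree and doubling loops cost \<open>6 * P\<close> each plus constants. The factor
      200 leaves slack.\<close>
    define P where "P = n * b * 2 ^ b"
    define Q where "Q = 2 ^ b * (n * (18 * b + 21) + 17)"
    have nb: "1 \<le> n * b" "n \<le> n * b" "b \<le> n * b" using n_pos b_pos by simp_all
    have "1 * 1 \<le> P" "n * 1 \<le> P" "b * 1 \<le> P"
      unfolding P_def by (intro mult_le_mono nb; simp)+
    moreover have "n * (18 * b + 21) + 17 \<le> 56 * (n * b)"
    proof -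
      define p where "p = n * b"
      have "n * (18 * b + 21) = 18 * p + 21 * n" by (simp add: p_def algebra_simps)
      then show ?thesis using nb unfolding p_def[symmetric] by linarith
    qed
    then have "Q \<le> 56 * P"
      using mult_le_mono2[of "n * (18 * b + 21) + 17" "56 * (n * b)" "2 ^ b"]
      by (simp add: Q_def P_def mult.commute)
    ultimately have "4 + Suc (4 + ((n * Suc 5 + 1) + (5 + ((b * Suc 5 + 1) + (2 +
       ((Q + 3) + (5 + (Q + 3)))))))) \<le> 200 * P"
      by simp
    then show "4 + Suc (4 + ((n * Suc 5 + 1) + (5 + ((b * Suc 5 + 1) + (2 +
       ((2 ^ b * (n * (18 * b + 21) + 17) + 3) + (5 + (2 ^ b * (n * (18 * b + 21) + 17) + 3)))))))) \<le>
       200 * n * b * 2 ^ b"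
      by (simp only: P_def Q_def mult.assoc)
  qed
  moreover have "tape \<sigma> = \<tau>" "work \<sigma> 1 = 2 ^ b" "work \<sigma> 0 = H"
    by (simp_all add: \<sigma>_def tape_mk work_mk)
  moreover have "\<bar>real H - 2 ^ b * reach_prob E (source X) (target X)\<bar> \<le> 3 * card E"
    if "is_sink E (target X)"
    using chips_discrepancy[OF c s that g] by (simp add: H_def)
  ultimately show ?thesis by blast
qed

end

section \<open>Resource bounds\<close>

lemma lg_ge_1: "1 \<le> lg x"
  using log_mono[of 2 2 "max 2 x"] by (simp add: lg_def)

lemma lg_mono: "x \<le> y \<Longrightarrow> lg x \<le> lg y"
  by (simp add: lg_def)

lemma le_lg: "0 < x \<Longrightarrow> log 2 x \<le> lg x"
  by (simp add: lg_def)

lemma soft_ge: "x * lg x \<le> soft 1 x" "1 \<le> soft 1 x"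
proof -
  show "x * lg x \<le> soft 1 x"
    using lg_ge_1[of x] by (simp add: soft_def mult_right_mono)
  have "2 * 1 \<le> max 2 x * lg x" using lg_ge_1[of x] by (intro mult_mono) auto
  then show "1 \<le> soft 1 x" by (simp add: soft_def)
qed

lemma floorlog_le_lg:
  assumes "real k \<le> a * x" "0 < a" "0 < x"
  shows "real (floorlog 2 k) \<le> 1 + log 2 a + lg x \<or> k = 0"
proof (cases "k = 0")
  case False
  then have "real (floorlog 2 k) = of_int \<lfloor>log 2 k\<rfloor> + 1"
    by (simp add: floorlog_def)
  also have "\<dots> \<le> log 2 k + 1" by simp
  also have "log 2 k \<le> log 2 (a * x)" using assms False by simp
  also have "\<dots> = log 2 a + log 2 x" using assms by (simp add: log_mult)
  finally show ?thesis using le_lg[OF assms(3)] by simp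
qed simp

lemma log_24_le: "log 2 24 \<le> 5" "log 2 12 \<le> 4"
  using log_of_power_le[of 24 2 5] log_of_power_le[of 12 2 4] by simp_all

context dag
begin

text \<open>The early exit: at most five registers are touched and the catalytic tape is not
  accessed, so the cost is constant however small \<open>n * m / \<epsilon>\<close> is.\<close>

lemma run_main_coarse:
  assumes "1 \<le> accuracy X"
  shows "run X 17 0 main_prog (initial \<tau>) 6
    (mk [0, 1, 0, 0, 0, 0, 0, 0, 0, 0, 0, 0, 1, 1, 0, 0, 0] \<tau>)"
proof -
  let ?\<sigma> = "mk [0, 1, 0, 0, 0, 0, 0, 0, 0, 0, 0, 0, 1, 1, 0, 0, 0] \<tau>"
  have init: "initial \<tau> = mk (replicate 17 0) \<tau>"
    by (simp add: initial_def mk_def fun_eq_iff)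
  have one: "floorlog 2 1 = 1" by (simp add: floorlog_def)
  have "block_sem X 17 1 0 [Const 12 1, Const 1 1, Accuracy_Ge 13 1 1] (replicate 17 0) \<tau>
      [0, 1, 0, 0, 0, 0, 0, 0, 0, 0, 0, 0, 1, 1, 0, 0, 0] \<tau>"
    using assms by (simp add: numeral_eq_Suc)
  then have "run X (17 * floorlog 2 1) 0 (block [Const 12 1, Const 1 1, Accuracy_Ge 13 1 1])
      (initial \<tau>) 4 ?\<sigma>"
    unfolding init by (intro run_mono[OF run_block]) simp_all
  then have "run X 17 0 (block [Const 12 1, Const 1 1, Accuracy_Ge 13 1 1]) (initial \<tau>) 4 ?\<sigma>"
    by (simp only: one mult_1_right)
  moreover have "run X 17 0 Skip ?\<sigma> 1 ?\<sigma>"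
    using run_block[of X 17 1 0 "[]" _ \<tau> _ \<tau>] one by (simp add: block_def)
  then have "run X 17 0 (Cond 13 Skip Q) ?\<sigma> (Suc 1) ?\<sigma>" for Q
    by (intro run_Cond_True) (simp_all add: work_mk)
  ultimately have "run X 17 0 main_prog (initial \<tau>) (4 + Suc 1) ?\<sigma>"
    unfolding main_prog_def by (rule run_Seq)
  then show ?thesis by simp
qed

lemma main_prog_spec:
  fixes m :: real
  assumes "m = max 1 (card E)"
  shows "\<exists>T w c \<sigma> \<rho>. exec X main_prog (initial \<tau>) T w c \<sigma> \<and> tape \<sigma> = \<tau> \<and> returns \<sigma> \<rho> \<and>
    T \<le> 12000 * soft 1 (num_verts X * m / accuracy X) \<and>
    w \<le> 12000 * lg (num_verts X * m / accuracy X) \<and>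
    c \<le> 12000 * soft 1 (num_verts X * lg (m / accuracy X)) \<and>
    (is_sink E (target X) \<longrightarrow> \<bar>\<rho> - reach_prob E (source X) (target X)\<bar> \<le> accuracy X)"
proof (cases "1 \<le> accuracy X")
  case True
  let ?\<sigma> = "mk [0, 1, 0, 0, 0, 0, 0, 0, 0, 0, 0, 0, 1, 1, 0, 0, 0] \<tau>"
  obtain T w c where ex: "exec X main_prog (initial \<tau>) T w c ?\<sigma>" "T \<le> 6" "w \<le> 17" "c \<le> 0"
    using run_main_coarse[OF True] unfolding run_def by blast
  have "returns ?\<sigma> 0" "tape ?\<sigma> = \<tau>" by (simp_all add: returns_def work_mk tape_mk)
  moreover have "\<bar>0 - reach_prob E (source X) (target X)\<bar> \<le> accuracy X"
    using True reach_prob_bounds[of "source X" "target X"] by simp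
  moreover have "T \<le> 12000 * soft 1 (num_verts X * m / accuracy X)"
    using ex(2) soft_ge(2)[of "num_verts X * m / accuracy X"] by linarith
  moreover have "w \<le> 12000 * lg (num_verts X * m / accuracy X)"
    using ex(3) lg_ge_1[of "num_verts X * m / accuracy X"] by linarith
  moreover have "c \<le> 12000 * soft 1 (num_verts X * lg (m / accuracy X))"
    using ex(4) soft_ge(2)[of "num_verts X * lg (m / accuracy X)"] by linarith
  ultimately show ?thesis using ex(1) by (intro exI conjI impI)
next
  case False
  define \<epsilon> where "\<epsilon> = accuracy X"
  define n where "n = num_verts X"
  have \<epsilon>: "0 < \<epsilon>" "\<epsilon> < 1" using accuracy False by (simp_all add: \<epsilon>_def)
  have n: "1 \<le> n" using source by (simp add: n_def)
  have m: "1 \<le> m" "card E \<le> m" using assms by simp_all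
  define enough where "enough i \<longleftrightarrow> 3 * real (card E + 1) \<le> 2 ^ i * \<epsilon>" for i :: nat
  define b where "b = (LEAST i. enough i)"
  have "\<exists>i. enough i"
  proof -
    obtain i where "3 * real (card E + 1) / \<epsilon> < 2 ^ i"
      using real_arch_pow[of 2 "3 * real (card E + 1) / \<epsilon>"] by auto
    then have "enough i" using \<epsilon> by (simp add: enough_def pos_divide_less_eq less_imp_le)
    then show ?thesis ..
  qed
  then have eb: "enough b" unfolding b_def by (rule LeastI_ex)
  have mono: "enough j" if "enough i" "i \<le> j" for i j
  proof -
    have "2 ^ i * \<epsilon> \<le> 2 ^ j * \<epsilon>" using that(2) \<epsilon> by (intro mult_right_mono power_increasing) auto
    with that(1) show ?thesis by (simp add: enough_def)
  qed
  have b_iff: "enough i \<longleftrightarrow> b \<le> i" for i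
    using mono[OF eb, of i] Least_le[of enough i] unfolding b_def by blast
  \<comment> \<open>Here \<open>card E + 1\<close> in place of \<open>card E\<close> matters: the
    test fails at 0 even without arcs, so the loop, which doubles at least once, stops at the least
    exponent.\<close>
  have "\<not> enough 0" using \<epsilon> by (simp add: enough_def)
  then have b_pos: "1 \<le> b" using b_iff[of 0] by simp
  then have "\<not> enough (b - 1)" using b_iff by simp
  \<comment> \<open>Minimality of \<open>b\<close>: half of \<open>K\<close> fails the test, which
    bounds \<open>K\<close> from above.\<close>
  then have "2 ^ (b - 1) * \<epsilon> < 3 * real (card E + 1)" by (simp add: enough_def)
  also have "\<dots> \<le> 6 * m" using m by simp
  finally have "2 ^ b * \<epsilon> < 12 * m" using b_pos by (cases b) (simp_all add: mult.commute)
  then have K_less: "2 ^ b < 12 * (m / \<epsilon>)"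
    using \<epsilon> by (simp add: pos_less_divide_eq)
  have me: "0 < m / \<epsilon>" using m \<epsilon> by simp
  have me_le: "m / \<epsilon> \<le> n * m / \<epsilon>" using n m \<epsilon> by (simp add: divide_right_mono)
  have "real b = log 2 (2 ^ b)" by (simp add: log_nat_power)
  also have "\<dots> \<le> log 2 (12 * (m / \<epsilon>))" using K_less by (intro log_mono) simp_all
  also have "\<dots> = log 2 12 + log 2 (m / \<epsilon>)" using me by (intro log_mult_pos) simp_all
  finally have b_le: "b \<le> 5 * lg (m / \<epsilon>)"
    using log_24_le(2) le_lg[OF me] lg_ge_1[of "m / \<epsilon>"] by linarith
  \<comment> \<open>The sharper bound without \<open>n\<close> is kept for the catalytic space; the
    time needs only this one.\<close>
  then have b_le': "b \<le> 5 * lg (n * m / \<epsilon>)" using lg_mono[OF me_le] by simp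

  interpret rotor_machine X b "n * b" "2 * n * 2 ^ b"
    by unfold_locales (use b_pos in \<open>simp_all add: n_def\<close>)
  obtain \<sigma> where \<sigma>: "run X (17 * floorlog 2 (2 * n * 2 ^ b)) (n * b) main_prog (initial \<tau>)
        (200 * n * b * 2 ^ b) \<sigma>" "tape \<sigma> = \<tau>" "work \<sigma> 1 = 2 ^ b"
      "is_sink E (target X) \<Longrightarrow>
        \<bar>real (work \<sigma> 0) - 2 ^ b * reach_prob E (source X) (target X)\<bar> \<le> 3 * card E"
    using run_main[of \<tau>, folded \<epsilon>_def n_def, OF \<epsilon>(2) b_iff[unfolded enough_def]] by blast
  then obtain T w c where ex: "exec X main_prog (initial \<tau>) T w c \<sigma>" "T \<le> 200 * n * b * 2 ^ b"
    "w \<le> 17 * floorlog 2 (2 * n * 2 ^ b)" "c \<le> n * b"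
    unfolding run_def by blast
  define \<rho> where "\<rho> = real (work \<sigma> 0) / real (work \<sigma> 1)"
  have "returns \<sigma> \<rho>" using \<sigma>(3) by (simp add: returns_def \<rho>_def)
  moreover have "\<bar>\<rho> - reach_prob E (source X) (target X)\<bar> \<le> \<epsilon>" if "is_sink E (target X)"
  proof -
    have "\<bar>real (work \<sigma> 0) - 2 ^ b * reach_prob E (source X) (target X)\<bar> \<le> 2 ^ b * \<epsilon>"
      using \<sigma>(4)[OF that] eb by (simp add: enough_def)
    moreover have "real (work \<sigma> 0) - 2 ^ b * reach_prob E (source X) (target X) =
        2 ^ b * (\<rho> - reach_prob E (source X) (target X))"
      unfolding \<rho>_def \<sigma>(3) by (simp add: field_simps)
    ultimately show ?thesis by (simp add: abs_mult)
  qed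
  moreover have "T \<le> 12000 * soft 1 (n * m / \<epsilon>)"
  proof -
    have "real T \<le> 200 * n * b * 2 ^ b" using of_nat_mono[OF ex(2)] by simp
    also have "\<dots> = 200 * n * (real b * 2 ^ b)" by simp
    \<comment> \<open>The final constant arises here: 12000 = 200 * 5 * 12, from the step count, the
      bound on \<open>b\<close> and the bound on \<open>2 ^ b\<close>.\<close>
    also have "\<dots> \<le> 200 * n * (5 * lg (n * m / \<epsilon>) * (12 * (m / \<epsilon>)))"
      using b_le' K_less by (intro mult_left_mono mult_mono) (auto simp: less_imp_le)
    also have "\<dots> = 12000 * (n * m / \<epsilon> * lg (n * m / \<epsilon>))" by (simp add: field_simps)
    also have "\<dots> \<le> 12000 * soft 1 (n * m / \<epsilon>)" by (intro mult_left_mono soft_ge(1)) simp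
    finally show ?thesis .
  qed
  moreover have "w \<le> 12000 * lg (n * m / \<epsilon>)"
  proof -
    have "real (2 * n * 2 ^ b) \<le> 24 * (n * m / \<epsilon>)"
      using mult_left_mono[of "2 ^ b" "12 * (m / \<epsilon>)" "2 * real n"] K_less by simp
    then have "real (floorlog 2 (2 * n * 2 ^ b)) \<le> 1 + log 2 24 + lg (n * m / \<epsilon>) \<or> 2 * n * 2 ^ b = 0"
      by (rule floorlog_le_lg) (use n m \<epsilon> in simp_all)
    then have "real (floorlog 2 (2 * n * 2 ^ b)) \<le> 7 * lg (n * m / \<epsilon>)"
      using n log_24_le(1) lg_ge_1[of "n * m / \<epsilon>"] by auto
    moreover have "real w \<le> 17 * real (floorlog 2 (2 * n * 2 ^ b))" using ex(3) by linarith
    ultimately show ?thesis using lg_ge_1[of "n * m / \<epsilon>"] by linarith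
  qed
  moreover have "c \<le> 12000 * soft 1 (n * lg (m / \<epsilon>))"
  proof -
    let ?y = "n * lg (m / \<epsilon>)"
    have "real c \<le> n * b" using of_nat_mono[OF ex(4)] by simp
    also have "\<dots> \<le> n * (5 * lg (m / \<epsilon>))" using b_le by (simp add: mult_left_mono)
    also have "\<dots> \<le> 5 * (?y * lg ?y)"
      using mult_left_mono[of 1 "lg ?y" ?y] lg_ge_1[of ?y] lg_ge_1[of "m / \<epsilon>"] by simp
    also have "\<dots> \<le> 12000 * soft 1 ?y" using soft_ge(1)[of ?y] soft_ge(2)[of ?y] by linarith
    finally show ?thesis .
  qed
  ultimately show ?thesis using ex(1) \<sigma>(2) unfolding n_def \<epsilon>_def by (intro exI conjI impI)
qed

end

theorem theorem4p1:
  "\<exists>(P :: program) (C :: real) (k :: nat). \<forall>(X :: walk_input) (\<tau> :: nat \<Rightarrow> bool).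
     dag_input X \<longrightarrow>
     (let n = real (num_verts X); m = real (max 1 (card (arcs X))); \<epsilon> = accuracy X in
      \<exists>T w c \<sigma> \<rho>.
        exec X P (initial \<tau>) T w c \<sigma> \<and> tape \<sigma> = \<tau> \<and> returns \<sigma> \<rho> \<and>
        real T \<le> C * soft k (n * m / \<epsilon>) \<and>
        real w \<le> C * lg (n * m / \<epsilon>) \<and>
        real c \<le> C * soft k (n * lg (m / \<epsilon>)) \<and>
        (is_sink (arcs X) (target X) \<longrightarrow>
           \<bar>\<rho> - reach_prob (arcs X) (source X) (target X)\<bar> \<le> \<epsilon>))"
proof (intro exI allI impI)
  fix X :: walk_input and \<tau> :: "nat \<Rightarrow> bool"
  assume "dag_input X"
  then interpret dag X by unfold_locales
  show "let n = real (num_verts X); m = real (max 1 (card (arcs X))); \<epsilon> = accuracy X in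
      \<exists>T w c \<sigma> \<rho>.
        exec X main_prog (initial \<tau>) T w c \<sigma> \<and> tape \<sigma> = \<tau> \<and> returns \<sigma> \<rho> \<and>
        real T \<le> 12000 * soft 1 (n * m / \<epsilon>) \<and>
        real w \<le> 12000 * lg (n * m / \<epsilon>) \<and>
        real c \<le> 12000 * soft 1 (n * lg (m / \<epsilon>)) \<and>
        (is_sink (arcs X) (target X) \<longrightarrow>
           \<bar>\<rho> - reach_prob (arcs X) (source X) (target X)\<bar> \<le> \<epsilon>)"
    unfolding Let_def by (rule main_prog_spec) simp
qed

end
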